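(* Let $n\geq 2$. Consider the following subspaces of the group algebra $\mathbb{Q}[\mathfrak{S}_n]$: \begin{align*} \mathcal{W}^{\pm}&=\mathrm{span}\{W_k^+,W_k^-:1\leq k\leq n-1\},\qquad \mathcal{W}=\mathrm{span}\{W_k:1\leq k\leq n-1\},\qquad \mathcal{W}^\circ=\mathrm{span}\{W_k^\circ:1\leq k\leq n\},\\ \mathcal{C}&=\mathrm{span}\{W_{2k}:1\leq k\leq \lfloor\tfrac{n-1}{2}\rfloor\}\oplus\mathrm{span}\{W_{2k-1}^+,W_{2k-1}^-:1\leq k\leq\lfloor\tfrac n2\rfloor\},\\ \mathcal{P}&=\mathrm{span}\{P_k:0\leq k\leq\lfloor\tfrac{n-1}{2}\rfloor\},\qquad \mathcal{P}^\circ=\mathrm{span}\{P^\circ_k:0\leq k\leq\lfloor\tfrac n2\rfloor\}. \end{align*} Then $\mathcal{W}^{\pm}$ is a subalgebra of the descent algebra $\mathcal{D}_n$, and $\mathcal{W}$, $\mathcal{W}^\circ$, $\mathcal{C}$, $\mathcal{P}$ and $\mathcal{P}^\circ$ are subalgebras of $\mathcal{W}^{\pm}$ (i.e. subspaces of $\mathcal{W}^\pm$ closed under multiplication).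
   Context: Permutations $\sigma\in\mathfrak{S}_n$ are written as words $\sigma_1\cdots\sigma_n$ with $\sigma_i=\sigma(i)$; the product is composition, $(\alpha\beta)(i)=\alpha(\beta(i))$. A descent of $\sigma$ is $i\in[n-1]$ with $\sigma_i>\sigma_{i+1}$; $\mathrm{Des}(\sigma)$ is the set of descents. The descent algebra $\mathcal{D}_n$ is the linear span in $\mathbb{Q}[\mathfrak{S}_n]$ of the elements $\sum_{\mathrm{Des}(\sigma)=I}\sigma$, $I\subseteq[n-1]$ (it is a subalgebra by Solomon's theorem). An alternating run of $\sigma$ is a maximal monotone sequence of consecutive entries of $\sigma_1,\dots,\sigma_n$; $\mathrm{run}(\sigma)$ is their number. A left run is a maximal monotone sequence of consecutive entries of $\sigma_0,\sigma_1,\dots,\sigma_n$ with $\sigma_0=0$; $\mathrm{run}^\circ(\sigma)$ is their number. Let $W_k^+$ (resp. $W_k^-$) be the sum of all $\sigma\in\mathfrak{S}_n$ with $\mathrm{run}(\sigma)=k$ whose first run is ascending, i.e. $\sigma_1<\sigma_2$ (resp. descending); $W_k=W_k^++W_k^-$; $W_k^\circ$ is the sum of all $\sigma$ with $\mathrm{run}^\circ(\sigma)=k$. A peak of $\sigma$ is $i$ with $2\le i\le n-1$ and $\sigma_{i-1}<\sigma_i>\sigma_{i+1}$; a left peak is $i$ with $1\leq i\leq n-1$ and $\sigma_{i-1}<\sigma_i>\sigma_{i+1}$ with the convention $\sigma_0=0$. $P_k$ (resp. $P_k^\circ$) is the sum of all $\sigma\in\mathfrak{S}_n$ with exactly $k$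 peaks (resp. $k$ left peaks). *)

theory Defs
  imports Complex_Main "HOL-Library.Poly_Mapping" "HOL-Combinatorics.Permutations"
begin

text \<open>
  Elements of the group algebra of the symmetric group over the rationals are represented as
  finitely supported functions on \<^typ>\<open>nat \<Rightarrow> nat\<close>; \<open>Poly_Mapping.single \<sigma> 1\<close> is the basis
  element of the permutation \<open>\<sigma>\<close>. The library's multiplication on \<open>\<Rightarrow>\<^sub>0\<close> is not the product of
  the group algebra (it is convolution with respect to addition of the indices), so both the
  product and the scalar multiplication are introduced here.
\<close>

type_synonym perm_alg = "(nat \<Rightarrow> nat) \<Rightarrow>\<^sub>0 rat"

definition pa_scale :: "rat \<Rightarrow> perm_alg \<Rightarrow> perm_alg" where
  "pa_scale c f = Poly_Mapping.map ((*) c) f"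

definition pa_mult :: "perm_alg \<Rightarrow> perm_alg \<Rightarrow> perm_alg" where
  "pa_mult f g =
     (\<Sum>\<alpha>\<in>Poly_Mapping.keys f. \<Sum>\<beta>\<in>Poly_Mapping.keys g.
        Poly_Mapping.single (\<alpha> \<circ> \<beta>) (Poly_Mapping.lookup f \<alpha> * Poly_Mapping.lookup g \<beta>))"

lemma lookup_pa_scale [simp]:
  "Poly_Mapping.lookup (pa_scale c f) \<sigma> = c * Poly_Mapping.lookup f \<sigma>"
  unfolding pa_scale_def by (simp add: map.rep_eq when_def)

global_interpretation perm_alg: vector_space pa_scale
  by unfold_locales (rule poly_mapping_eqI, simp add: lookup_add algebra_simps)+

definition sym_perms :: "nat \<Rightarrow> (nat \<Rightarrow> nat) set" where
  "sym_perms n = {\<sigma>. \<sigma> permutes {1..n}}"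

definition class_sum :: "nat \<Rightarrow> ((nat \<Rightarrow> nat) \<Rightarrow> bool) \<Rightarrow> perm_alg" where
  "class_sum n Q = (\<Sum>\<sigma> | \<sigma> \<in> sym_perms n \<and> Q \<sigma>. Poly_Mapping.single \<sigma> 1)"

definition Des :: "nat \<Rightarrow> (nat \<Rightarrow> nat) \<Rightarrow> nat set" where
  "Des n \<sigma> = {i \<in> {1..n - 1}. \<sigma> i > \<sigma> (i + 1)}"

definition descent_algebra :: "nat \<Rightarrow> perm_alg set" where
  "descent_algebra n = perm_alg.span {class_sum n (\<lambda>\<sigma>. Des n \<sigma> = I) | I. I \<subseteq> {1..n - 1}}"

definition monotone_segment :: "(nat \<Rightarrow> nat) \<Rightarrow> nat \<Rightarrow> nat \<Rightarrow> bool" where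
  "monotone_segment w i j \<longleftrightarrow>
     strict_mono_on {i..j} w \<or> strict_antimono_on {i..j} w"

text \<open>
  The maximal monotone sequences of consecutive entries of \<open>w l, \<dots>, w r\<close>, each
  represented by the positions of its first and last entries.
\<close>

definition maximal_runs :: "nat \<Rightarrow> nat \<Rightarrow> (nat \<Rightarrow> nat) \<Rightarrow> (nat \<times> nat) set" where
  "maximal_runs l r w =
     {(i, j). l \<le> i \<and> i \<le> j \<and> j \<le> r \<and> monotone_segment w i j \<and>
        (\<forall>i' j'. l \<le> i' \<and> i' \<le> i \<and> j \<le> j' \<and> j' \<le> r \<and> monotone_segment w i' j'
           \<longrightarrow> i' = i \<and> j' = j)}"

definition run :: "nat \<Rightarrow> (nat \<Rightarrow> nat) \<Rightarrow> nat" where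
  "run n \<sigma> = card (maximal_runs 1 n \<sigma>)"

text \<open>
  If \<open>\<sigma> permutes {1..n}\<close> then \<open>\<sigma> 0 = 0\<close>, which is the convention on the 0-th entry used for
  left runs and left peaks.
\<close>

definition left_run :: "nat \<Rightarrow> (nat \<Rightarrow> nat) \<Rightarrow> nat" where
  "left_run n \<sigma> = card (maximal_runs 0 n \<sigma>)"

definition peaks :: "nat \<Rightarrow> (nat \<Rightarrow> nat) \<Rightarrow> nat set" where
  "peaks n \<sigma> = {i \<in> {2..n - 1}. \<sigma> (i - 1) < \<sigma> i \<and> \<sigma> i > \<sigma> (i + 1)}"

definition left_peaks :: "nat \<Rightarrow> (nat \<Rightarrow> nat) \<Rightarrow> nat set" where
  "left_peaks n \<sigma> = {i \<in> {1..n - 1}. \<sigma> (i - 1) < \<sigma> i \<and> \<sigma> i > \<sigma> (i + 1)}"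

definition W_plus :: "nat \<Rightarrow> nat \<Rightarrow> perm_alg" where
  "W_plus n k = class_sum n (\<lambda>\<sigma>. run n \<sigma> = k \<and> \<sigma> 1 < \<sigma> 2)"

definition W_minus :: "nat \<Rightarrow> nat \<Rightarrow> perm_alg" where
  "W_minus n k = class_sum n (\<lambda>\<sigma>. run n \<sigma> = k \<and> \<sigma> 1 > \<sigma> 2)"

definition W_both :: "nat \<Rightarrow> nat \<Rightarrow> perm_alg" where
  "W_both n k = W_plus n k + W_minus n k"

definition W_left :: "nat \<Rightarrow> nat \<Rightarrow> perm_alg" where
  "W_left n k = class_sum n (\<lambda>\<sigma>. left_run n \<sigma> = k)"

definition P_int :: "nat \<Rightarrow> nat \<Rightarrow> perm_alg" where
  "P_int n k = class_sum n (\<lambda>\<sigma>. card (peaks n \<sigma>) = k)"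

definition P_left :: "nat \<Rightarrow> nat \<Rightarrow> perm_alg" where
  "P_left n k = class_sum n (\<lambda>\<sigma>. card (left_peaks n \<sigma>) = k)"

definition W_pm_space :: "nat \<Rightarrow> perm_alg set" where
  "W_pm_space n = perm_alg.span (W_plus n ` {1..n - 1} \<union> W_minus n ` {1..n - 1})"

definition W_space :: "nat \<Rightarrow> perm_alg set" where
  "W_space n = perm_alg.span (W_both n ` {1..n - 1})"

definition W_left_space :: "nat \<Rightarrow> perm_alg set" where
  "W_left_space n = perm_alg.span (W_left n ` {1..n})"

definition C_even_space :: "nat \<Rightarrow> perm_alg set" where
  "C_even_space n = perm_alg.span ((\<lambda>k. W_both n (2 * k)) ` {1..(n - 1) div 2})"

definition C_odd_space :: "nat \<Rightarrow> perm_alg set" where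
  "C_odd_space n =
     perm_alg.span ((\<lambda>k. W_plus n (2 * k - 1)) ` {1..n div 2} \<union>
                    (\<lambda>k. W_minus n (2 * k - 1)) ` {1..n div 2})"

definition C_space :: "nat \<Rightarrow> perm_alg set" where
  "C_space n = {x + y | x y. x \<in> C_even_space n \<and> y \<in> C_odd_space n}"

definition P_space :: "nat \<Rightarrow> perm_alg set" where
  "P_space n = perm_alg.span (P_int n ` {0..(n - 1) div 2})"

definition P_left_space :: "nat \<Rightarrow> perm_alg set" where
  "P_left_space n = perm_alg.span (P_left n ` {0..n div 2})"

text \<open>
  Subalgebras need not contain the identity: for \<open>n \<ge> 2\<close>, \<^term>\<open>W_space n\<close> does not.
\<close>

definition subalgebra_of :: "perm_alg set \<Rightarrow> perm_alg set \<Rightarrow> bool" where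
  "subalgebra_of A B \<longleftrightarrow>
     A \<subseteq> B \<and> perm_alg.subspace A \<and> (\<forall>x\<in>A. \<forall>y\<in>A. pa_mult x y \<in> A)"

end

theory Submission
  imports Defs "HOL-Computational_Algebra.Formal_Power_Series" "HOL-Library.FuncSet"
begin

text \<open>
  Take an interval of natural numbers as an alphabet in which even letters are positive and odd
  letters negative. A word of length \<open>n\<close> determines the permutation that sorts its positions, equal
  positive letters being read from left to right and equal negative letters from right to left. Let
  \<open>B a m\<close> be the sum of these permutations over all words in the letters \<open>a, \<dots>, a + m - 1\<close>.
  Ordering pairs of letters lexicographically, with the second order reversed below a negative first
  letter, turns a product of two alternating alphabets into an alternating alphabet, so the elements
  \<open>B a m\<close> with \<open>a \<in> {0, 1}\<close> are closed under multiplication.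

  The coefficient of \<open>\<sigma>\<close> in \<open>B a m\<close> depends only on the number \<open>k\<close> of direction changes of \<open>\<sigma>\<close>,
  where an initial direction given by the sign of \<open>a\<close> is prepended. Its generating function in \<open>m\<close>
  is, with \<open>R = 1 / (1 - X\<^sup>2)\<close>, \<open>S = (1 + X\<^sup>2) R\<close> and \<open>D = 2 X R\<close>, a shift of \<open>H\<^sub>k + H\<^sub>k\<^sub>+\<^sub>1\<close> where
  \<open>H\<^sub>q = S\<^sup>n\<^sup>-\<^sup>q D\<^sup>q R\<close> starts at \<open>X\<^sup>q\<close> and has the parity of \<open>q\<close>. By triangularity the \<open>B 0 m\<close> span
  \<open>\<W>\<^sup>\<circ>\<close>, all of them span \<open>\<W>\<^sup>\<plusminus>\<close>, and since for fixed parity of \<open>m\<close> only one of the two summands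
  survives, the \<open>B 1 (2 m)\<close> span \<open>\<P>\<close> and the \<open>B 0 (2 m + 1)\<close> span \<open>\<P>\<^sup>\<circ>\<close>. Finally, \<open>\<W>\<close> and \<open>\<C>\<close> consist of
  the elements of \<open>\<W>\<^sup>\<plusminus>\<close> fixed by left multiplication with, respectively conjugation by, the
  reversing permutation.
\<close>

section \<open>The group algebra and class sums\<close>

text \<open>\<open>pa_mult\<close> sums over exact supports, which may shrink when elements are
  added or scaled. Common finite supersets of the supports make bilinearity a termwise
  identity.\<close>

lemma pa_mult_superset:
  assumes "finite A" "finite B" "Poly_Mapping.keys f \<subseteq> A" "Poly_Mapping.keys g \<subseteq> B"
  shows "pa_mult f g = (\<Sum>\<alpha>\<in>A. \<Sum>\<beta>\<in>B.
    Poly_Mapping.single (\<alpha> \<circ> \<beta>) (Poly_Mapping.lookup f \<alpha> * Poly_Mapping.lookup g \<beta>))"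
proof -
  have inner: "(\<Sum>\<beta>\<in>Poly_Mapping.keys g.
        Poly_Mapping.single (\<alpha> \<circ> \<beta>) (Poly_Mapping.lookup f \<alpha> * Poly_Mapping.lookup g \<beta>))
     = (\<Sum>\<beta>\<in>B.
        Poly_Mapping.single (\<alpha> \<circ> \<beta>) (Poly_Mapping.lookup f \<alpha> * Poly_Mapping.lookup g \<beta>))" for \<alpha>
    using assms by (intro sum.mono_neutral_left) (auto simp: in_keys_iff)
  show ?thesis
    unfolding pa_mult_def inner
    using assms by (intro sum.mono_neutral_left) (auto simp: in_keys_iff)
qed

lemma pa_mult_add_left: "pa_mult (f + f') g = pa_mult f g + pa_mult f' g"
proof -
  let ?A = "Poly_Mapping.keys f \<union> Poly_Mapping.keys f'" and ?B = "Poly_Mapping.keys g"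
  have "Poly_Mapping.keys (f + f') \<subseteq> ?A"
    by (rule Poly_Mapping.keys_add)
  then show ?thesis
    by (simp add: pa_mult_superset[of ?A ?B] lookup_add distrib_right single_add sum.distrib)
qed

lemma pa_mult_add_right: "pa_mult f (g + g') = pa_mult f g + pa_mult f g'"
proof -
  let ?B = "Poly_Mapping.keys g \<union> Poly_Mapping.keys g'" and ?A = "Poly_Mapping.keys f"
  have "Poly_Mapping.keys (g + g') \<subseteq> ?B"
    by (rule Poly_Mapping.keys_add)
  then show ?thesis
    by (simp add: pa_mult_superset[of ?A ?B] lookup_add distrib_left single_add sum.distrib)
qed

lemma pa_scale_single: "pa_scale c (Poly_Mapping.single \<sigma> d) = Poly_Mapping.single \<sigma> (c * d)"
  by (rule poly_mapping_eqI) (simp add: lookup_single when_def)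

lemma keys_pa_scale: "Poly_Mapping.keys (pa_scale c f) \<subseteq> Poly_Mapping.keys f"
  by (auto simp: in_keys_iff)

lemma pa_mult_scale_left: "pa_mult (pa_scale c f) g = pa_scale c (pa_mult f g)"
  using keys_pa_scale[of c f]
  by (simp add: pa_mult_superset[of "Poly_Mapping.keys f" "Poly_Mapping.keys g"]
      perm_alg.scale_sum_right pa_scale_single mult.assoc)

lemma pa_mult_scale_right: "pa_mult f (pa_scale c g) = pa_scale c (pa_mult f g)"
  using keys_pa_scale[of c g]
  by (simp add: pa_mult_superset[of "Poly_Mapping.keys f" "Poly_Mapping.keys g"]
      perm_alg.scale_sum_right pa_scale_single mult.left_commute)

lemma pa_mult_zero_left [simp]: "pa_mult 0 g = 0" and pa_mult_zero_right [simp]: "pa_mult f 0 = 0"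
  by (simp_all add: pa_mult_def)

lemma pa_mult_sum_left: "pa_mult (sum f I) g = (\<Sum>i\<in>I. pa_mult (f i) g)"
  by (induction I rule: infinite_finite_induct) (simp_all add: pa_mult_add_left)

lemma pa_mult_sum_right: "pa_mult f (sum g I) = (\<Sum>i\<in>I. pa_mult f (g i))"
  by (induction I rule: infinite_finite_induct) (simp_all add: pa_mult_add_right)

lemma pa_mult_single_single:
  "pa_mult (Poly_Mapping.single \<alpha> c) (Poly_Mapping.single \<beta> d) = Poly_Mapping.single (\<alpha> \<circ> \<beta>) (c * d)"
  by (simp add: pa_mult_superset[of "{\<alpha>}" "{\<beta>}"])

text \<open>Linear extension from basis elements: identities such as associativity reduce to
  identities between compositions of permutations.\<close>

lemma poly_mapping_single_add_induct [case_names zero single add]: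
  fixes f :: "'a \<Rightarrow>\<^sub>0 'b::comm_monoid_add"
  assumes "P 0" "\<And>x c. P (Poly_Mapping.single x c)" "\<And>f g. P f \<Longrightarrow> P g \<Longrightarrow> P (f + g)"
  shows "P f"
proof -
  have "P (\<Sum>x\<in>A. Poly_Mapping.single x (Poly_Mapping.lookup f x))" for A
    by (induction A rule: infinite_finite_induct) (simp_all add: assms)
  moreover have "f = (\<Sum>x\<in>Poly_Mapping.keys f. Poly_Mapping.single x (Poly_Mapping.lookup f x))"
    by (rule poly_mapping_eqI) (simp add: lookup_sum lookup_single when_def in_keys_iff)
  ultimately show ?thesis
    by metis
qed

lemma pa_mult_assoc: "pa_mult (pa_mult f g) h = pa_mult f (pa_mult g h)"
proof (induction f rule: poly_mapping_single_add_induct)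
  case (single \<alpha> a)
  show ?case
  proof (induction g rule: poly_mapping_single_add_induct)
    case (single \<beta> b)
    show ?case
      by (induction h rule: poly_mapping_single_add_induct)
        (simp_all add: pa_mult_single_single pa_mult_add_right comp_assoc mult.assoc)
  qed (simp_all add: pa_mult_add_left pa_mult_add_right)
qed (simp_all add: pa_mult_add_left)

section \<open>Spans and products\<close>

lemma span_mult_closed:
  assumes "\<And>x y. x \<in> S \<Longrightarrow> y \<in> S \<Longrightarrow> pa_mult x y \<in> perm_alg.span S"
    and "x \<in> perm_alg.span S" "y \<in> perm_alg.span S"
  shows "pa_mult x y \<in> perm_alg.span S"
  using assms(2)
proof (induction rule: perm_alg.span_induct_alt)
  case base
  show ?case by (simp add: perm_alg.span_zero)
next
  case (step c s z)
  from assms(3) have "pa_mult s y \<in> perm_alg.span S"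
  proof (induction rule: perm_alg.span_induct_alt)
    case base
    show ?case by (simp add: perm_alg.span_zero)
  next
    case (step c' s' z')
    then show ?case
      using assms(1)[OF \<open>s \<in> S\<close>]
      by (simp add: pa_mult_add_right pa_mult_scale_right perm_alg.span_add perm_alg.span_scale)
  qed
  with step.IH show ?case
    by (simp add: pa_mult_add_left pa_mult_scale_left perm_alg.span_add perm_alg.span_scale)
qed

text \<open>The rows \<open>i \<le> N\<close> form an invertible lower triangular matrix, so the
  \<open>p j\<close> are recovered one after another; the rows \<open>i > N\<close> stay in the span
  of the \<open>p j\<close>. This form admits alphabets of unbounded size.\<close>

lemma span_triangular:
  fixes b p :: "nat \<Rightarrow> perm_alg" and t :: "nat \<Rightarrow> nat \<Rightarrow> rat"
  assumes b: "\<And>i. b i = (\<Sum>j\<le>N. pa_scale (t i j) (p j))"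
    and upper: "\<And>i j. i < j \<Longrightarrow> t i j = 0" and diag: "\<And>j. t j j \<noteq> 0"
  shows "perm_alg.span (range b) = perm_alg.span (p ` {0..N})"
proof (rule subset_antisym)
  have "b i \<in> perm_alg.span (p ` {0..N})" for i
    unfolding b
    by (intro perm_alg.span_sum perm_alg.span_scale perm_alg.span_base) auto
  then show "perm_alg.span (range b) \<subseteq> perm_alg.span (p ` {0..N})"
    by (intro perm_alg.span_minimal perm_alg.subspace_span) auto
next
  have "p j \<in> perm_alg.span (range b)" if "j \<le> N" for j
    using that
  proof (induction j rule: less_induct)
    case (less j)
    have "b j = (\<Sum>i\<in>{..j}. pa_scale (t j i) (p i))"
      unfolding b using less.prems upper by (intro sum.mono_neutral_right) auto
    also have "\<dots> = (\<Sum>i<j. pa_scale (t j i) (p i)) + pa_scale (t j j) (p j)"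
      by (simp add: lessThan_Suc_atMost[symmetric])
    finally have "pa_scale (t j j) (p j) = b j - (\<Sum>i<j. pa_scale (t j i) (p i))"
      by simp
    also have "\<dots> \<in> perm_alg.span (range b)"
      using less by (intro perm_alg.span_diff perm_alg.span_sum perm_alg.span_scale)
        (auto intro: perm_alg.span_base)
    finally have "pa_scale (inverse (t j j)) (pa_scale (t j j) (p j)) \<in> perm_alg.span (range b)"
      by (rule perm_alg.span_scale)
    then show ?case
      using diag[of j] by simp
  qed
  then show "perm_alg.span (p ` {0..N}) \<subseteq> perm_alg.span (range b)"
    by (intro perm_alg.span_minimal perm_alg.subspace_span) auto
qed

section \<open>Class sums\<close>

lemma finite_sym_perms: "finite (sym_perms n)"
  by (simp add: sym_perms_def finite_permutations)

lemma lookup_class_sum: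
  "Poly_Mapping.lookup (class_sum n Q) \<sigma> = of_bool (\<sigma> \<in> sym_perms n \<and> Q \<sigma>)"
  using finite_sym_perms[of n]
  by (auto simp: class_sum_def lookup_sum lookup_single when_def sum.delta')

lemma class_sum_cong:
  "(\<And>\<sigma>. \<sigma> \<in> sym_perms n \<Longrightarrow> Q \<sigma> = Q' \<sigma>) \<Longrightarrow> class_sum n Q = class_sum n Q'"
  by (rule poly_mapping_eqI) (auto simp: lookup_class_sum)

text \<open>Such a \<open>Q\<close> selects whole descent classes, so its class sum is the sum of
  the classes indexed by \<open>?J\<close>.\<close>

lemma class_sum_in_descent_algebra:
  assumes "\<And>\<sigma> \<tau>. \<sigma> \<in> sym_perms n \<Longrightarrow> \<tau> \<in> sym_perms n \<Longrightarrow> Des n \<sigma> = Des n \<tau> \<Longrightarrow> Q \<sigma> \<Longrightarrow> Q \<tau>"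
  shows "class_sum n Q \<in> descent_algebra n"
proof -
  let ?J = "Des n ` {\<sigma> \<in> sym_perms n. Q \<sigma>}"
  have fin: "finite ?J"
    using finite_sym_perms[of n] by simp
  have "class_sum n Q = (\<Sum>I\<in>?J. class_sum n (\<lambda>\<sigma>. Des n \<sigma> = I))"
  proof (rule poly_mapping_eqI)
    fix \<sigma>
    have "(\<Sum>I\<in>?J. of_bool (\<sigma> \<in> sym_perms n \<and> Des n \<sigma> = I) :: rat)
        = (\<Sum>I\<in>?J. if Des n \<sigma> = I then of_bool (\<sigma> \<in> sym_perms n) else 0)"
      by (intro sum.cong) auto
    also have "\<dots> = of_bool (\<sigma> \<in> sym_perms n \<and> Q \<sigma>)"
      unfolding sum.delta'[OF fin] using assms by auto
    finally show "Poly_Mapping.lookup (class_sum n Q) \<sigma>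
        = Poly_Mapping.lookup (\<Sum>I\<in>?J. class_sum n (\<lambda>\<sigma>. Des n \<sigma> = I)) \<sigma>"
      by (simp add: lookup_class_sum lookup_sum)
  qed
  also have "\<dots> \<in> descent_algebra n"
    unfolding descent_algebra_def
    by (intro perm_alg.span_sum perm_alg.span_base) (auto simp: Des_def)
  finally show ?thesis .
qed

section \<open>Sorting sums and their products\<close>

text \<open>
  The parity of a letter is its sign: ties between even letters are broken by increasing, ties
  between odd letters by decreasing position.
\<close>

definition prec :: "(nat \<Rightarrow> nat) \<Rightarrow> nat \<Rightarrow> nat \<Rightarrow> bool" where
  "prec w p q \<longleftrightarrow> w p < w q \<or> w p = w q \<and> (if even (w p) then p < q else q < p)"

lemma prec_irrefl: "\<not> prec w p p"
  by (simp add: prec_def)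

lemma prec_trans: "prec w p q \<Longrightarrow> prec w q r \<Longrightarrow> prec w p r"
  by (auto simp: prec_def split: if_splits)

lemma prec_total: "p \<noteq> q \<Longrightarrow> prec w p q \<or> prec w q p"
  by (auto simp: prec_def)

definition prec_rank :: "nat \<Rightarrow> (nat \<Rightarrow> nat) \<Rightarrow> nat \<Rightarrow> nat" where
  "prec_rank n w p = (if p \<in> {1..n} then Suc (card {q \<in> {1..n}. prec w q p}) else p)"

text \<open>The inverse of the standardization: \<open>sorting n w i\<close> is the position of the
  i-th letter in sorted order, so that \<open>w \<circ> sorting n w\<close> increases weakly on
  \<open>{1..n}\<close>.\<close>

definition sorting :: "nat \<Rightarrow> (nat \<Rightarrow> nat) \<Rightarrow> nat \<Rightarrow> nat" where
  "sorting n w = inv (prec_rank n w)"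

lemma prec_rank_mono:
  assumes "p \<in> {1..n}" "q \<in> {1..n}" "prec w p q"
  shows "prec_rank n w p < prec_rank n w q"
proof -
  have "{r \<in> {1..n}. prec w r p} \<subset> {r \<in> {1..n}. prec w r q}"
    using assms prec_trans prec_irrefl by blast
  then have "card {r \<in> {1..n}. prec w r p} < card {r \<in> {1..n}. prec w r q}"
    by (intro psubset_card_mono) auto
  then show ?thesis
    using assms by (simp add: prec_rank_def)
qed

lemma prec_rank_permutes: "prec_rank n w permutes {1..n}"
proof -
  have inj: "inj_on (prec_rank n w) {1..n}"
    by (rule inj_onI) (metis less_irrefl prec_rank_mono prec_total)
  have "prec_rank n w ` {1..n} \<subseteq> {1..n}"
  proof clarify
    fix p assume p: "p \<in> {1..n}"
    then have "{q \<in> {1..n}. prec w q p} \<subset> {1..n}"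
      using prec_irrefl by blast
    then have "card {q \<in> {1..n}. prec w q p} < card {1..n}"
      by (intro psubset_card_mono) auto
    with p show "prec_rank n w p \<in> {1..n}"
      by (simp add: prec_rank_def)
  qed
  then have "bij_betw (prec_rank n w) {1..n} {1..n}"
    unfolding bij_betw_def using inj endo_inj_surj by blast
  then show ?thesis
    by (rule bij_imp_permutes) (auto simp: prec_rank_def)
qed

lemma sorting_permutes: "sorting n w permutes {1..n}"
  unfolding sorting_def by (rule permutes_inv[OF prec_rank_permutes])

lemma prec_sorting:
  assumes "i \<in> {1..n}" "j \<in> {1..n}" "i < j"
  shows "prec w (sorting n w i) (sorting n w j)"
proof (rule ccontr)
  assume *: "\<not> ?thesis"
  have rank: "prec_rank n w (sorting n w k) = k" for k
    unfolding sorting_def by (rule permutes_inverses(1)[OF prec_rank_permutes])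
  have "sorting n w i \<noteq> sorting n w j"
    using assms(3) rank by (metis less_irrefl)
  with * have "prec w (sorting n w j) (sorting n w i)"
    using prec_total by blast
  moreover have "sorting n w i \<in> {1..n}" "sorting n w j \<in> {1..n}"
    using assms permutes_in_image[OF sorting_permutes] by blast+
  ultimately show False
    using prec_rank_mono[of "sorting n w j" n "sorting n w i" w] rank assms(3) by simp
qed

text \<open>The positions before \<open>\<tau> i\<close> are exactly the \<open>\<tau> j\<close>
  with \<open>1 \<le> j < i\<close>, so the rank of \<open>\<tau> i\<close> is \<open>i\<close> and
  \<open>\<tau>\<close> inverts \<open>prec_rank n w\<close>.\<close>

lemma sorting_unique:
  assumes perm: "\<tau> permutes {1..n}"
    and sorted: "\<And>i j. i \<in> {1..n} \<Longrightarrow> j \<in> {1..n} \<Longrightarrow> i < j \<Longrightarrow> prec w (\<tau> i) (\<tau> j)"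
  shows "sorting n w = \<tau>"
proof -
  have "prec_rank n w (\<tau> i) = i" for i
  proof (cases "i \<in> {1..n}")
    case True
    then have "\<tau> i \<in> {1..n}"
      using permutes_in_image[OF perm] by blast
    moreover have "{q \<in> {1..n}. prec w q (\<tau> i)} = \<tau> ` {1..<i}"
    proof (intro subset_antisym subsetI)
      fix q assume q: "q \<in> {q \<in> {1..n}. prec w q (\<tau> i)}"
      then obtain j where j: "j \<in> {1..n}" "q = \<tau> j"
        using permutes_image[OF perm] by blast
      then have "j < i"
        using q True sorted prec_irrefl prec_trans
        by (metis (mono_tags, lifting) linorder_neqE_nat mem_Collect_eq)
      with j show "q \<in> \<tau> ` {1..<i}"
        by auto
    next
      fix q assume "q \<in> \<tau> ` {1..<i}"
      then obtain j where "j \<in> {1..<i}" "q = \<tau> j"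
        by blast
      then show "q \<in> {q \<in> {1..n}. prec w q (\<tau> i)}"
        using True sorted[of j i] permutes_in_image[OF perm, of j] by auto
    qed
    moreover have "card (\<tau> ` {1..<i}) = i - 1"
      using permutes_inj_on[OF perm] by (simp add: card_image)
    ultimately show ?thesis
      using True by (simp add: prec_rank_def)
  next
    case False
    then show ?thesis
      using permutes_not_in[OF perm False] unfolding prec_rank_def by presburger
  qed
  then show ?thesis
    unfolding sorting_def using permutes_inj[OF prec_rank_permutes]
    by (metis ext inv_f_eq)
qed

text \<open>Transitivity reduces the order to neighbours. The words sorted by \<open>\<tau>\<close>
  are thereby described by local conditions along a chain, as for P-partitions.\<close>

lemma sorting_eq_iff:
  assumes perm: "\<tau> permutes {1..n}"
  shows "sorting n w = \<tau> \<longleftrightarrow> (\<forall>j\<in>{1..<n}. prec w (\<tau> j) (\<tau> (Suc j)))"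
proof
  assume "sorting n w = \<tau>"
  then show "\<forall>j\<in>{1..<n}. prec w (\<tau> j) (\<tau> (Suc j))"
    using prec_sorting by auto
next
  assume adj: "\<forall>j\<in>{1..<n}. prec w (\<tau> j) (\<tau> (Suc j))"
  have "prec w (\<tau> i) (\<tau> (Suc (i + d)))" if "1 \<le> i" "Suc (i + d) \<le> n" for i d
    using that
  proof (induction d)
    case 0
    then show ?case using adj by simp
  next
    case (Suc d)
    then have "prec w (\<tau> (Suc (i + d))) (\<tau> (Suc (Suc (i + d))))"
      using adj by simp
    with Suc show ?case
      using prec_trans by fastforce
  qed
  then have "prec w (\<tau> i) (\<tau> j)" if "i \<in> {1..n}" "j \<in> {1..n}" "i < j" for i j
    using that less_imp_Suc_add[of i j] by auto
  then show "sorting n w = \<tau>"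
    by (rule sorting_unique[OF perm])
qed

section \<open>Sums over words and products of alphabets\<close>

definition words :: "nat \<Rightarrow> nat \<Rightarrow> nat \<Rightarrow> (nat \<Rightarrow> nat) set" where
  "words n a m = {1..n} \<rightarrow>\<^sub>E {a..<a + m}"

definition sorting_sum :: "nat \<Rightarrow> nat \<Rightarrow> nat \<Rightarrow> perm_alg" where
  "sorting_sum n a m = (\<Sum>w\<in>words n a m. Poly_Mapping.single (sorting n w) 1)"

text \<open>
  The rank of the pair \<open>(v, u)\<close> in the lexicographic order that reverses the order of \<open>u\<close> when \<open>v\<close>
  is odd, started at \<open>e\<close>; \<open>pair_origin\<close> is the value of \<open>e\<close> that makes signs multiplicative.
\<close>

definition pair_letter :: "nat \<Rightarrow> nat \<Rightarrow> nat \<Rightarrow> nat \<Rightarrow> nat \<Rightarrow> nat \<Rightarrow> nat" where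
  "pair_letter a m b e v u =
     e + (v - b) * m + (if even v then u - a else a + m - Suc u)"

definition pair_origin :: "nat \<Rightarrow> nat \<Rightarrow> nat \<Rightarrow> nat" where
  "pair_origin a m b = (if even m then a else (a + b) mod 2)"

lemma pair_letter_less_fst:
  assumes "u \<in> {a..<a + m}" "u' \<in> {a..<a + m}" "b \<le> v" "v < v'"
  shows "pair_letter a m b e v u < pair_letter a m b e v' u'"
proof -
  have "pair_letter a m b e v u < e + (v - b) * m + m"
    using assms(1) by (auto simp: pair_letter_def)
  also have "\<dots> = e + Suc (v - b) * m"
    by simp
  also have "\<dots> \<le> e + (v' - b) * m"
    using assms(3,4) by (intro add_left_mono mult_right_mono) auto
  also have "\<dots> \<le> pair_letter a m b e v' u'"
    by (simp add: pair_letter_def)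
  finally show ?thesis .
qed

lemma pair_letter_less_snd:
  assumes "u \<in> {a..<a + m}" "u' \<in> {a..<a + m}" "if even v then u < u' else u' < u"
  shows "pair_letter a m b e v u < pair_letter a m b e v u'"
  using assms by (auto simp: pair_letter_def split: if_splits)

text \<open>Signs multiply. For even \<open>m\<close> all blocks start with the same parity, and
  reversing a block flips parities. For odd \<open>m\<close> reversal keeps parities, while the
  starting parity of a block alternates with \<open>v\<close>; the origin
  \<open>(a + b) mod 2\<close> aligns this alternation with the sign of \<open>v\<close>.\<close>

lemma even_pair_letter:
  assumes "u \<in> {a..<a + m}" "b \<le> v"
  shows "even (pair_letter a m b (pair_origin a m b) v u) \<longleftrightarrow> (even v \<longleftrightarrow> even u)"
proof -
  obtain x where x: "u = a + x" "x < m"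
    using assms(1) le_Suc_ex by force
  obtain y where y: "v = b + y"
    using assms(2) le_Suc_ex by blast
  obtain z where z: "m = Suc (x + z)"
    using x(2) less_imp_Suc_add by blast
  show ?thesis
    unfolding pair_letter_def pair_origin_def x(1) y z by auto
qed

text \<open>Strict lexicographic monotonicity gives injectivity, and both sides have
  \<open>l * m\<close> elements.\<close>

lemma pair_letter_bij:
  "bij_betw (\<lambda>(v, u). pair_letter a m b e v u) ({b..<b + l} \<times> {a..<a + m}) {e..<e + l * m}"
proof -
  let ?f = "\<lambda>(v, u). pair_letter a m b e v u" and ?D = "{b..<b + l} \<times> {a..<a + m}"
  have "inj_on ?f ?D"
  proof (rule inj_onI, clarify)
    fix v u v' u'
    assume "v \<in> {b..<b + l}" "u \<in> {a..<a + m}" "v' \<in> {b..<b + l}" "u' \<in> {a..<a + m}"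
      "pair_letter a m b e v u = pair_letter a m b e v' u'"
    then show "v = v' \<and> u = u'"
      using pair_letter_less_fst[of u a m u' b v v' e] pair_letter_less_fst[of u' a m u b v' v e]
        pair_letter_less_snd[of u a m u' v b e] pair_letter_less_snd[of u' a m u v b e]
      by (metis atLeastLessThan_iff less_irrefl linorder_neqE_nat)
  qed
  moreover have "?f ` ?D \<subseteq> {e..<e + l * m}"
  proof clarify
    fix v u assume *: "v \<in> {b..<b + l}" "u \<in> {a..<a + m}"
    then have "pair_letter a m b e v u < e + (v - b) * m + m"
      by (auto simp: pair_letter_def)
    also have "\<dots> = e + Suc (v - b) * m"
      by simp
    also have "\<dots> \<le> e + l * m"
      using * by (intro add_left_mono mult_right_mono) auto
    finally show "pair_letter a m b e v u \<in> {e..<e + l * m}"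
      by (simp add: pair_letter_def)
  qed
  moreover have "card ?D = card {e..<e + l * m}"
    by simp
  ultimately show ?thesis
    by (metis bij_betw_def card_image card_subset_eq finite_atLeastLessThan)
qed

lemma words_comp_permutes:
  assumes "\<tau> permutes {1..n}" "w \<in> words n a m"
  shows "w \<circ> \<tau> \<in> words n a m"
  using assms permutes_in_image[OF assms(1)] permutes_not_in[OF assms(1)]
  unfolding words_def by (auto simp: PiE_iff extensional_def)

text \<open>A tie of \<open>v\<close> is broken by comparing ranks under \<open>sorting n u\<close>,
  upwards or downwards by the sign of the letter, and comparing ranks means comparing letters of
  \<open>u\<close>: this is the lexicographic order with reversal. If the letters of
  \<open>u\<close> tie as well, the position rule of \<open>u\<close> is applied in the direction
  given by \<open>v\<close>, which is the rule for the product of the signs.\<close>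

lemma sorting_comp:
  assumes u: "u \<in> words n a m" and v: "v \<in> words n b l"
  defines "w \<equiv> \<lambda>p. pair_letter a m b (pair_origin a m b) (v (inv (sorting n u) p)) (u p)"
  shows "sorting n w = sorting n u \<circ> sorting n v"
proof (rule sorting_unique)
  show "sorting n u \<circ> sorting n v permutes {1..n}"
    by (intro permutes_compose sorting_permutes)
next
  fix i j assume ij: "i \<in> {1..n}" "j \<in> {1..n}" "i < j"
  let ?\<alpha> = "sorting n u" and ?p = "sorting n v i" and ?q = "sorting n v j"
  have pq: "?p \<in> {1..n}" "?q \<in> {1..n}"
    using ij permutes_in_image[OF sorting_permutes] by blast+
  then have \<alpha>pq: "?\<alpha> ?p \<in> {1..n}" "?\<alpha> ?q \<in> {1..n}"
    using permutes_in_image[OF sorting_permutes] by blast+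
  have in_u: "u (?\<alpha> ?p) \<in> {a..<a + m}" "u (?\<alpha> ?q) \<in> {a..<a + m}"
    using u \<alpha>pq unfolding words_def by blast+
  have in_v: "b \<le> v ?p" "b \<le> v ?q"
    using v pq unfolding words_def by (meson PiE_mem atLeastLessThan_iff)+
  have inv: "inv ?\<alpha> (?\<alpha> k) = k" for k
    by (rule permutes_inverses(2)[OF sorting_permutes])
  have up: "prec u (?\<alpha> ?p) (?\<alpha> ?q)" if "?p < ?q"
    using prec_sorting[OF pq that] .
  have down: "prec u (?\<alpha> ?q) (?\<alpha> ?p)" if "?q < ?p"
    using prec_sorting[OF pq(2,1) that] .
  note less_fst = pair_letter_less_fst[OF in_u in_v(1)]
    and less_snd = pair_letter_less_snd[OF in_u]
    and par = even_pair_letter[OF in_u(1) in_v(1)]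
  have "prec v ?p ?q"
    by (rule prec_sorting[OF ij])
  then show "prec w ((?\<alpha> \<circ> sorting n v) i) ((?\<alpha> \<circ> sorting n v) j)"
    using less_fst less_snd par up down
    unfolding prec_def w_def comp_def inv by (auto split: if_splits)
qed

lemma sorting_cong:
  assumes "\<And>p. p \<in> {1..n} \<Longrightarrow> w p = w' p"
  shows "sorting n w = sorting n w'"
proof (rule sorting_unique[OF sorting_permutes])
  fix i j assume ij: "i \<in> {1..n}" "j \<in> {1..n}" "i < j"
  then have "sorting n w' i \<in> {1..n}" "sorting n w' j \<in> {1..n}"
    using permutes_in_image[OF sorting_permutes] by blast+
  then show "prec w (sorting n w' i) (sorting n w' j)"
    using prec_sorting[OF ij, of w'] assms by (simp add: prec_def)
qed

lemma sorting_sum_mult: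
  "pa_mult (sorting_sum n a m) (sorting_sum n b l) = sorting_sum n (pair_origin a m b) (l * m)"
proof -
  define e where "e = pair_origin a m b"
  let ?c = "pair_letter a m b e"
  let ?c' = "inv_into ({b..<b + l} \<times> {a..<a + m}) (\<lambda>(v, u). ?c v u)"
  define pw where "pw v u = restrict (\<lambda>p. ?c (v p) (u p)) {1..n}" for v u :: "nat \<Rightarrow> nat"
  note bij = pair_letter_bij[of a m b e l]
  \<comment> \<open>For fixed \<open>u\<close>, composing with the inverse of
    \<open>sorting n u\<close> permutes the words \<open>v\<close>; after this change of variable
    the letters of \<open>u\<close> and \<open>v\<close> are paired at the same position.\<close>
  have "(\<Sum>v\<in>words n b l. Poly_Mapping.single (sorting n u \<circ> sorting n v) (1::rat))
      = (\<Sum>v\<in>words n b l. Poly_Mapping.single (sorting n (pw v u)) 1)"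
    if u: "u \<in> words n a m" for u
  proof (rule sum.reindex_bij_witness[where i = "\<lambda>v. v \<circ> sorting n u"
        and j = "\<lambda>v. v \<circ> inv (sorting n u)"])
    fix v assume v: "v \<in> words n b l"
    show "v \<circ> inv (sorting n u) \<circ> sorting n u = v" "v \<circ> sorting n u \<circ> inv (sorting n u) = v"
      using permutes_inverses[OF sorting_permutes] by (simp_all add: fun_eq_iff)
    show "v \<circ> inv (sorting n u) \<in> words n b l" "v \<circ> sorting n u \<in> words n b l"
      using v by (auto intro!: words_comp_permutes permutes_inv sorting_permutes)
    have "sorting n (pw (v \<circ> inv (sorting n u)) u) = sorting n u \<circ> sorting n v"
      unfolding sorting_comp[OF u v, symmetric]
      by (rule sorting_cong) (simp add: pw_def e_def)
    then show "Poly_Mapping.single (sorting n (pw (v \<circ> inv (sorting n u)) u)) (1::rat)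
        = Poly_Mapping.single (sorting n u \<circ> sorting n v) 1"
      by simp
  qed
  then have "pa_mult (sorting_sum n a m) (sorting_sum n b l)
      = (\<Sum>u\<in>words n a m. \<Sum>v\<in>words n b l. Poly_Mapping.single (sorting n (pw v u)) 1)"
    unfolding sorting_sum_def pa_mult_sum_left
    by (simp add: pa_mult_sum_right pa_mult_single_single)
  also have "\<dots> = (\<Sum>(u, v)\<in>words n a m \<times> words n b l. Poly_Mapping.single (sorting n (pw v u)) 1)"
    by (simp add: sum.cartesian_product)
  \<comment> \<open>Pairs of words correspond letter by letter, through
    \<open>pair_letter_bij\<close>, to words over the product alphabet. The restrictions keep
    functions undefined outside \<open>{1..n}\<close>, as \<open>words\<close> demands.\<close>
  also have "\<dots> = (\<Sum>w\<in>words n e (l * m). Poly_Mapping.single (sorting n w) 1)"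
  proof (rule sum.reindex_bij_witness[where j = "\<lambda>(u, v). pw v u"
        and i = "\<lambda>w. (restrict (\<lambda>p. snd (?c' (w p))) {1..n}, restrict (\<lambda>p. fst (?c' (w p))) {1..n})"])
    fix uv assume uv: "uv \<in> words n a m \<times> words n b l"
    obtain u v where [simp]: "uv = (u, v)" by force
    have in_D: "(v p, u p) \<in> {b..<b + l} \<times> {a..<a + m}" if "p \<in> {1..n}" for p
      using uv that unfolding words_def by (auto simp: PiE_iff)
    then have c': "?c' (?c (v p) (u p)) = (v p, u p)" if "p \<in> {1..n}" for p
      using bij_betw_inv_into_left[OF bij, of "(v p, u p)"] that by simp
    have "restrict u {1..n} = u" "restrict v {1..n} = v"
      using uv unfolding words_def by (auto simp: PiE_restrict)
    moreover have "restrict (\<lambda>p. snd (?c' (pw v u p))) {1..n} = restrict u {1..n}"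
      "restrict (\<lambda>p. fst (?c' (pw v u p))) {1..n} = restrict v {1..n}"
      by (rule restrict_ext, simp add: pw_def c')+
    ultimately show "(restrict (\<lambda>p. snd (?c' ((\<lambda>(u, v). pw v u) uv p))) {1..n},
        restrict (\<lambda>p. fst (?c' ((\<lambda>(u, v). pw v u) uv p))) {1..n}) = uv"
      by simp
    show "(\<lambda>(u, v). pw v u) uv \<in> words n e (l * m)"
      using in_D bij_betw_apply[OF bij] unfolding words_def pw_def by fastforce
  next
    fix w assume w: "w \<in> words n e (l * m)"
    have in_D: "?c' (w p) \<in> {b..<b + l} \<times> {a..<a + m}" and c': "case ?c' (w p) of (v, u) \<Rightarrow> ?c v u = w p"
      if "p \<in> {1..n}" for p
    proof -
      have "w p \<in> {e..<e + l * m}"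
        using w that unfolding words_def by blast
      then show "?c' (w p) \<in> {b..<b + l} \<times> {a..<a + m}" "case ?c' (w p) of (v, u) \<Rightarrow> ?c v u = w p"
        using bij_betw_apply[OF bij_betw_inv_into[OF bij]] bij_betw_inv_into_right[OF bij, of "w p"]
        by (auto split: prod.splits)
    qed
    show "(restrict (\<lambda>p. snd (?c' (w p))) {1..n}, restrict (\<lambda>p. fst (?c' (w p))) {1..n})
        \<in> words n a m \<times> words n b l"
      using in_D unfolding words_def by (auto simp: mem_Times_iff)
    have "pw (restrict (\<lambda>p. fst (?c' (w p))) {1..n}) (restrict (\<lambda>p. snd (?c' (w p))) {1..n})
        = restrict w {1..n}"
      unfolding pw_def using c' by (intro restrict_ext) (simp add: case_prod_beta)
    also have "\<dots> = w"
      using w unfolding words_def by (rule PiE_restrict)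
    finally show "(\<lambda>(u, v). pw v u)
       (restrict (\<lambda>p. snd (?c' (w p))) {1..n}, restrict (\<lambda>p. fst (?c' (w p))) {1..n}) = w"
      by simp
  qed auto
  finally show ?thesis
    by (simp add: sorting_sum_def e_def)
qed

section \<open>Counting letter paths\<close>

text \<open>\<open>y\<close> and \<open>z\<close> are neighbours in sorted order. Equal positive
  letters are read at increasing positions and equal negative letters at decreasing ones, so a tie
  is allowed only where the sign of the letter agrees with the direction \<open>d\<close>.\<close>

definition step_ok :: "bool \<Rightarrow> nat \<Rightarrow> nat \<Rightarrow> bool" where
  "step_ok d y z \<longleftrightarrow> y < z \<or> y = z \<and> even y = d"

text \<open>
  The sorted sequences \<open>w \<circ> \<sigma>\<close> of words sorted by \<open>\<sigma>\<close>, with last letter \<open>z\<close>, when \<open>d j\<close> tells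
  whether \<open>\<sigma>\<close> ascends at \<open>j\<close>. The value \<open>d 0\<close> is irrelevant here; it is the sign of \<open>a\<close> below.
\<close>

definition letter_paths :: "nat \<Rightarrow> (nat \<Rightarrow> bool) \<Rightarrow> nat \<Rightarrow> nat \<Rightarrow> (nat \<Rightarrow> nat) set" where
  "letter_paths a d N z =
     {f \<in> {1..Suc N} \<rightarrow>\<^sub>E {a..}. (\<forall>j\<in>{1..N}. step_ok (d j) (f j) (f (Suc j))) \<and> f (Suc N) = z}"

lemma letter_paths_0: "letter_paths a d 0 z = (if a \<le> z then {\<lambda>i. if i = 1 then z else undefined} else {})"
  by (auto simp: letter_paths_def PiE_iff extensional_def fun_eq_iff)

lemma letter_paths_Suc:
  "letter_paths a d (Suc N) z
     = (\<Union>y\<in>{y. step_ok (d (Suc N)) y z}. (\<lambda>f. f(Suc (Suc N) := z)) ` letter_paths a d N y)"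
    (is "?L = ?R")
proof (intro subset_antisym subsetI)
  fix f assume f: "f \<in> ?L"
  let ?g = "f(Suc (Suc N) := undefined)"
  have "?g \<in> letter_paths a d N (f (Suc N))"
    using f unfolding letter_paths_def by (auto simp: PiE_iff extensional_def)
  moreover have "step_ok (d (Suc N)) (f (Suc N)) z" "f = ?g(Suc (Suc N) := z)"
    using f unfolding letter_paths_def by auto
  ultimately show "f \<in> ?R"
    by blast
next
  fix f assume "f \<in> ?R"
  then obtain y g where yg: "step_ok (d (Suc N)) y z" "g \<in> letter_paths a d N y"
    "f = g(Suc (Suc N) := z)"
    by blast
  then have "a \<le> y"
    unfolding letter_paths_def by (auto simp: PiE_iff)
  then have "a \<le> z"
    using yg(1) by (auto simp: step_ok_def)
  then show "f \<in> ?L"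
    using yg unfolding letter_paths_def by (auto simp: PiE_iff extensional_def le_Suc_eq)
qed

lemma finite_step_ok: "finite {y. step_ok c y z}"
  by (rule finite_subset[of _ "{..z}"]) (auto simp: step_ok_def)

lemma finite_letter_paths: "finite (letter_paths a d N z)"
  by (induction N arbitrary: z)
    (simp_all add: letter_paths_0 letter_paths_Suc finite_step_ok)

lemma card_letter_paths_Suc:
  "card (letter_paths a d (Suc N) z)
     = (\<Sum>y<z. card (letter_paths a d N y)) + of_bool (even z = d (Suc N)) * card (letter_paths a d N z)"
proof -
  have inj: "inj_on (\<lambda>f. f(Suc (Suc N) := z)) (letter_paths a d N y)" for y
  proof (rule inj_onI)
    fix f g assume "f \<in> letter_paths a d N y" "g \<in> letter_paths a d N y"
      and eq: "f(Suc (Suc N) := z) = g(Suc (Suc N) := z)"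
    then have "f (Suc (Suc N)) = g (Suc (Suc N))"
      unfolding letter_paths_def by (auto simp: PiE_iff extensional_def)
    with eq show "f = g"
      by (metis fun_upd_triv fun_upd_upd)
  qed
  have "card (letter_paths a d (Suc N) z)
      = (\<Sum>y | step_ok (d (Suc N)) y z. card ((\<lambda>f. f(Suc (Suc N) := z)) ` letter_paths a d N y))"
    unfolding letter_paths_Suc
  proof (intro card_UN_disjoint ballI impI)
    fix y y' :: nat assume "y \<noteq> y'"
    moreover have "f (Suc N) = x" if "f \<in> (\<lambda>f. f(Suc (Suc N) := z)) ` letter_paths a d N x" for f x
      using that unfolding letter_paths_def by auto
    ultimately show "(\<lambda>f. f(Suc (Suc N) := z)) ` letter_paths a d N y
        \<inter> (\<lambda>f. f(Suc (Suc N) := z)) ` letter_paths a d N y' = {}"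
      by blast
  qed (simp_all add: finite_step_ok finite_letter_paths)
  also have "\<dots> = (\<Sum>y | step_ok (d (Suc N)) y z. card (letter_paths a d N y))"
    by (simp add: card_image[OF inj])
  also have "{y. step_ok (d (Suc N)) y z} = {..<z} \<union> (if even z = d (Suc N) then {z} else {})"
    by (auto simp: step_ok_def)
  also have "(\<Sum>y\<in>\<dots>. card (letter_paths a d N y))
      = (\<Sum>y<z. card (letter_paths a d N y)) + of_bool (even z = d (Suc N)) * card (letter_paths a d N z)"
    by auto
  finally show ?thesis .
qed

section \<open>Parity of power series and generating functions of paths\<close>

definition has_parity :: "bool \<Rightarrow> 'a::zero fps \<Rightarrow> bool" where
  "has_parity p F \<longleftrightarrow> (\<forall>k. even k \<noteq> p \<longrightarrow> fps_nth F k = 0)"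

definition parity_part :: "bool \<Rightarrow> 'a::zero fps \<Rightarrow> 'a fps" where
  "parity_part p F = Abs_fps (\<lambda>k. if even k = p then fps_nth F k else 0)"

lemma parity_part_add: "parity_part p (F + G) = parity_part p F + parity_part p (G :: 'a::monoid_add fps)"
  by (rule fps_ext) (simp add: parity_part_def)

lemma parity_part_eq: "has_parity p F \<Longrightarrow> parity_part q F = (if q = p then F else 0)"
  by (rule fps_ext) (auto simp: parity_part_def has_parity_def)

text \<open>\<open>True\<close> stands for even, so parities add by equality of truth
  values.\<close>

lemma has_parity_mult:
  fixes F G :: "'a::semiring_0 fps"
  assumes "has_parity p F" "has_parity q G"
  shows "has_parity (p = q) (F * G)"
  unfolding has_parity_def
proof (intro allI impI)
  fix k :: nat assume k: "even k \<noteq> (p = q)"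
  have "fps_nth F i * fps_nth G (k - i) = 0" if "i \<in> {0..k}" for i
  proof (cases "even i = p")
    case True
    then have "even (k - i) \<noteq> q"
      using k that by (cases p; cases q) auto
    then show ?thesis
      using assms(2) by (simp add: has_parity_def)
  next
    case False
    then show ?thesis
      using assms(1) by (simp add: has_parity_def)
  qed
  then show "fps_nth (F * G) k = 0"
    unfolding fps_mult_nth by (intro sum.neutral) blast
qed

lemma has_parity_power:
  assumes "has_parity p (F :: 'a::semiring_1 fps)"
  shows "has_parity (p \<or> even k) (F ^ k)"
proof (induction k)
  case 0
  show ?case by (simp add: has_parity_def)
next
  case (Suc k)
  show ?case
    using has_parity_mult[OF assms Suc] by (cases p) auto
qed

text \<open>\<open>geo2\<close>, \<open>stay_fps\<close> and \<open>flip_fps\<close> are the series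
  R, S and D of the introduction.\<close>

definition geo2 :: "rat fps" where
  "geo2 = Abs_fps (\<lambda>k. of_bool (even k))"

definition stay_fps :: "rat fps" where
  "stay_fps = (1 + fps_X ^ 2) * geo2"

definition flip_fps :: "rat fps" where
  "flip_fps = 2 * fps_X * geo2"

lemma geo2_inverse: "(1 - fps_X) * (1 + fps_X) * geo2 = 1"
proof -
  have "(1 - fps_X) * (1 + fps_X) * geo2 = geo2 - fps_X ^ 2 * geo2"
    by (simp add: algebra_simps power2_eq_square)
  also have "\<dots> = 1"
  proof (rule fps_ext)
    fix k :: nat
    consider "k = 0" | "k = 1" | "2 \<le> k" by linarith
    then show "fps_nth (geo2 - fps_X ^ 2 * geo2) k = fps_nth 1 k"
      by cases (auto simp: fps_X_power_mult_nth geo2_def)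
  qed
  finally show ?thesis .
qed

text \<open>By \<open>geo2_inverse\<close> this series is (1 + X) / (1 - X), so
  \<open>stay_fps\<close> and \<open>flip_fps\<close> are its even and odd parts.\<close>

lemma stay_plus_flip: "stay_fps + flip_fps = (1 + fps_X) ^ 2 * geo2"
  by (simp add: stay_fps_def flip_fps_def power2_eq_square algebra_simps)

lemma has_parity_geo2: "has_parity True geo2"
  by (simp add: has_parity_def geo2_def)

lemma has_parity_stay: "has_parity True stay_fps"
proof -
  have "has_parity True (1 + fps_X ^ 2 :: rat fps)"
    by (auto simp: has_parity_def)
  from has_parity_mult[OF this has_parity_geo2] show ?thesis
    by (simp add: stay_fps_def)
qed

lemma has_parity_flip: "has_parity False flip_fps"
proof -
  have "has_parity False (2 * fps_X :: rat fps)"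
    by (auto simp: has_parity_def fps_numeral_fps_const)
  from has_parity_mult[OF this has_parity_geo2] show ?thesis
    by (simp add: flip_fps_def)
qed

definition flips :: "(nat \<Rightarrow> bool) \<Rightarrow> nat \<Rightarrow> nat" where
  "flips d N = (\<Sum>j<N. of_bool (d j \<noteq> d (Suc j)))"

lemma flips_Suc: "flips d (Suc N) = flips d N + of_bool (d N \<noteq> d (Suc N))"
  by (simp add: flips_def)

lemma flips_le: "flips d N \<le> N"
  by (induction N) (auto simp: flips_def of_bool_def)

lemma even_flips: "even (flips d N) \<longleftrightarrow> d 0 = d N"
  by (induction N) (auto simp: flips_def of_bool_def)

definition paths_fps :: "nat \<Rightarrow> (nat \<Rightarrow> bool) \<Rightarrow> nat \<Rightarrow> rat fps" where
  "paths_fps a d N = Abs_fps (\<lambda>z. of_nat (card (letter_paths a d N z)))"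

lemma paths_fps_0: "(1 - fps_X) * paths_fps a d 0 = fps_X ^ a"
proof (rule fps_ext)
  fix k
  show "fps_nth ((1 - fps_X) * paths_fps a d 0) k = fps_nth (fps_X ^ a) k"
    by (cases k) (auto simp: left_diff_distrib paths_fps_def letter_paths_0)
qed

text \<open>The factor 1 - X takes differences of consecutive coefficients, and exactly one of
  \<open>k - 1\<close> and \<open>k\<close> has the parity \<open>d (Suc N)\<close>. The count at
  \<open>k - 1\<close> gained by the sum is cancelled by the tie term at \<open>k - 1\<close> if
  \<open>k\<close> has the wrong parity, and joined by the tie term at \<open>k\<close>
  otherwise.\<close>

lemma paths_fps_Suc:
  "(1 - fps_X) * paths_fps a d (Suc N) = parity_part (d (Suc N)) ((1 + fps_X) * paths_fps a d N)"
proof (rule fps_ext)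
  fix k
  show "fps_nth ((1 - fps_X) * paths_fps a d (Suc N)) k
      = fps_nth (parity_part (d (Suc N)) ((1 + fps_X) * paths_fps a d N)) k"
    by (cases k) (auto simp: left_diff_distrib distrib_right paths_fps_def parity_part_def card_letter_paths_Suc)
qed

text \<open>The left-hand series has the parity of \<open>d N\<close>, starting with X^a.
  Multiplying by S + D and keeping the parity of the next direction leaves the S term if the
  direction is kept and the D term if it flips.\<close>

lemma paths_fps_eq:
  assumes "d 0 = even a"
  shows "(1 - fps_X) * paths_fps a d N
    = fps_X ^ a * (stay_fps ^ (N - flips d N) * flip_fps ^ flips d N)"
proof (induction N)
  case 0
  then show ?case by (simp add: paths_fps_0 flips_def)
next
  case (Suc N)
  let ?k = "flips d N" and ?E = "paths_fps a d N"
  let ?Y = "fps_X ^ a * (stay_fps ^ (N - ?k) * flip_fps ^ ?k)"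
  have "has_parity (even a) (fps_X ^ a :: rat fps)"
    by (auto simp: has_parity_def)
  then have "has_parity (even a = (True = even ?k)) ?Y"
    using has_parity_power[OF has_parity_stay, of "N - ?k"] has_parity_power[OF has_parity_flip, of ?k]
    by (intro has_parity_mult) simp_all
  then have Y: "has_parity (d N) ?Y"
    using assms by (cases "d N"; cases "even a") (simp_all add: even_flips)
  \<comment> \<open>Since 1 + X = (1 + X)^2 R (1 - X), a new letter multiplies the series by S + D
    before a parity is selected.\<close>
  have "(1 + fps_X) * ?E = (1 + fps_X) * ((1 - fps_X) * (1 + fps_X) * geo2) * ?E"
    by (simp add: geo2_inverse)
  also have "\<dots> = (1 + fps_X) ^ 2 * geo2 * ((1 - fps_X) * ?E)"
    by (simp add: power2_eq_square algebra_simps)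
  also have "\<dots> = stay_fps * ?Y + flip_fps * ?Y"
    unfolding stay_plus_flip[symmetric] Suc.IH by (simp add: distrib_right)
  finally have "(1 - fps_X) * paths_fps a d (Suc N)
      = parity_part (d (Suc N)) (stay_fps * ?Y) + parity_part (d (Suc N)) (flip_fps * ?Y)"
    by (simp add: paths_fps_Suc parity_part_add)
  also have "\<dots> = (if d (Suc N) = d N then stay_fps * ?Y else flip_fps * ?Y)"
    using parity_part_eq[OF has_parity_mult[OF has_parity_stay Y]]
      parity_part_eq[OF has_parity_mult[OF has_parity_flip Y]] by auto
  also have "\<dots> = fps_X ^ a * (stay_fps ^ (Suc N - flips d (Suc N)) * flip_fps ^ flips d (Suc N))"
    using flips_le[of d N] by (auto simp: flips_Suc Suc_diff_le)
  finally show ?case .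
qed

text \<open>The series H_q of the introduction.\<close>

definition coef_fps :: "nat \<Rightarrow> nat \<Rightarrow> rat fps" where
  "coef_fps n q = stay_fps ^ (n - q) * flip_fps ^ q * geo2"

lemma has_parity_coef: "has_parity (even q) (coef_fps n q)"
  using has_parity_mult[OF has_parity_mult[OF has_parity_power[OF has_parity_stay, of "n - q"]
      has_parity_power[OF has_parity_flip, of q]] has_parity_geo2]
  by (simp add: coef_fps_def)

text \<open>Each D contributes one factor X, so the series starts with 2^q X^q. The triangularity
  below comes from this.\<close>

lemma coef_fps_factor:
  "coef_fps n q = fps_X ^ q * (stay_fps ^ (n - q) * (2 * geo2) ^ q * geo2)"
  by (simp add: coef_fps_def flip_fps_def power_mult_distrib algebra_simps)

lemma coef_fps_below: "L < q \<Longrightarrow> fps_nth (coef_fps n q) L = 0"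
  by (simp add: coef_fps_factor fps_X_power_mult_nth)

lemma coef_fps_diag: "fps_nth (coef_fps n q) q \<noteq> 0"
  by (simp add: coef_fps_factor fps_X_power_mult_nth fps_nth_power_0 fps_numeral_fps_const
      stay_fps_def geo2_def)

text \<open>Bounding the last letter instead of fixing it divides by another 1 - X. As 1 / (1 - X)^2
  = (S + D) R, the two summands produce H_k and H_(k+1).\<close>

lemma sum_paths_eq:
  assumes "d 0 = even a"
  shows "(\<Sum>z\<le>a + L. of_nat (card (letter_paths a d N z)))
    = fps_nth (coef_fps (Suc N) (flips d N) + coef_fps (Suc N) (Suc (flips d N))) L"
proof -
  let ?k = "flips d N" and ?E = "paths_fps a d N"
  define G where "G = Abs_fps (\<lambda>k. \<Sum>z\<le>k. fps_nth ?E z)"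
  have G: "(1 - fps_X) * G = ?E"
  proof (rule fps_ext)
    fix k
    show "fps_nth ((1 - fps_X) * G) k = fps_nth ?E k"
      by (cases k) (auto simp: left_diff_distrib G_def)
  qed
  have "G = ((1 - fps_X) * (1 + fps_X) * geo2) ^ 2 * G"
    by (simp add: geo2_inverse)
  also have "\<dots> = (1 + fps_X) ^ 2 * geo2 * geo2 * ((1 - fps_X) * ((1 - fps_X) * G))"
    by (simp add: power2_eq_square algebra_simps)
  also have "\<dots> = fps_X ^ a * (coef_fps (Suc N) ?k + coef_fps (Suc N) (Suc ?k))"
    using flips_le[of d N]
    unfolding G paths_fps_eq[of d a, OF assms] stay_plus_flip[symmetric]
    by (simp add: coef_fps_def Suc_diff_le algebra_simps)
  finally have "fps_nth G (a + L) = fps_nth (coef_fps (Suc N) ?k + coef_fps (Suc N) (Suc ?k)) L"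
    by (simp add: fps_X_power_mult_nth)
  then show ?thesis
    by (simp add: G_def paths_fps_def)
qed

section \<open>Runs, peaks and direction changes\<close>

lemma monotone_on_interval_iff:
  fixes w :: "nat \<Rightarrow> 'a"
  assumes "transp R"
  shows "monotone_on {i..j} (<) R w \<longleftrightarrow> (\<forall>k\<in>{i..<j}. R (w k) (w (Suc k)))"
proof
  assume "monotone_on {i..j} (<) R w"
  then show "\<forall>k\<in>{i..<j}. R (w k) (w (Suc k))"
    by (auto simp: monotone_on_def)
next
  assume adj: "\<forall>k\<in>{i..<j}. R (w k) (w (Suc k))"
  have "R (w x) (w (Suc (x + e)))" if "i \<le> x" "Suc (x + e) \<le> j" for x e
    using that
  proof (induction e)
    case 0
    then show ?case using adj by simp
  next
    case (Suc e)
    then have "R (w x) (w (Suc (x + e)))" "R (w (Suc (x + e))) (w (Suc (x + Suc e)))"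
      using adj by simp_all
    then show ?case
      by (rule transpD[OF assms])
  qed
  then show "monotone_on {i..j} (<) R w"
    unfolding monotone_on_def by (metis atLeastAtMost_iff less_imp_Suc_add)
qed

lemma monotone_segment_iff:
  assumes "\<And>k. l \<le> k \<Longrightarrow> k < r \<Longrightarrow> w k \<noteq> w (Suc k)" "l \<le> i" "j \<le> r"
  shows "monotone_segment w i j \<longleftrightarrow> (\<forall>k\<in>{i..<j}. (w k < w (Suc k)) = (w i < w (Suc i)))"
proof -
  have "w (Suc k) < w k \<longleftrightarrow> \<not> w k < w (Suc k)" if "k \<in> {i..<j}" for k
    using assms(1)[of k] assms(2,3) that by auto
  then have "monotone_segment w i j \<longleftrightarrow>
      (\<forall>k\<in>{i..<j}. w k < w (Suc k)) \<or> (\<forall>k\<in>{i..<j}. \<not> w k < w (Suc k))"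
    unfolding monotone_segment_def
    using monotone_on_interval_iff[of "(<)" i j w] monotone_on_interval_iff[of "(>)" i j w] by simp
  moreover have "i \<in> {i..<j} \<or> {i..<j} = {}"
    by auto
  ultimately show ?thesis
    by blast
qed

text \<open>A maximal run is determined by its first position, and a run starts at \<open>l\<close>
  and wherever the direction changes. There are \<open>r - l\<close> directions, hence
  \<open>r - l - 1\<close> places for a change.\<close>

lemma card_maximal_runs:
  assumes neq: "\<And>k. l \<le> k \<Longrightarrow> k < r \<Longrightarrow> w k \<noteq> w (Suc k)" and "l < r"
  shows "card (maximal_runs l r w) = Suc (flips (\<lambda>j. w (l + j) < w (Suc (l + j))) (r - l - 1))"
proof -
  define D where "D k \<longleftrightarrow> w k < w (Suc k)" for k
  define starts where "starts = {i. l \<le> i \<and> i < r \<and> (l < i \<longrightarrow> D (i - 1) \<noteq> D i)}"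
  have seg: "monotone_segment w i j \<longleftrightarrow> (\<forall>k\<in>{i..<j}. D k = D i)" if "l \<le> i" "j \<le> r" for i j
    using monotone_segment_iff[of l r w, OF neq that] by (simp add: D_def)
  have "inj_on fst (maximal_runs l r w)"
  proof (rule inj_onI, clarify)
    fix i j i' j'
    assume "(i, j) \<in> maximal_runs l r w" "(i', j') \<in> maximal_runs l r w" "fst (i, j) = fst (i', j')"
    then show "i = i' \<and> j = j'"
      unfolding maximal_runs_def using linorder_linear[of j j'] order_refl[of i]
      by (simp only: mem_Collect_eq prod.case fst_conv) metis
  qed
  moreover have "fst ` maximal_runs l r w = starts"
  proof (intro subset_antisym subsetI)
    fix i assume "i \<in> fst ` maximal_runs l r w"
    then obtain j where "(i, j) \<in> maximal_runs l r w"
      by force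
    then have ij: "l \<le> i" "i \<le> j" "j \<le> r" and mono: "monotone_segment w i j"
      and maximal: "\<And>i' j'. l \<le> i' \<Longrightarrow> i' \<le> i \<Longrightarrow> j \<le> j' \<Longrightarrow> j' \<le> r \<Longrightarrow> monotone_segment w i' j'
        \<Longrightarrow> i' = i \<and> j' = j"
      unfolding maximal_runs_def by blast+
    \<comment> \<open>Two neighbouring entries always form a monotone segment, so a maximal run has
      at least two entries and cannot start at \<open>r\<close>.\<close>
    have "i < r"
    proof (rule ccontr)
      assume "\<not> i < r"
      then have "i = r" "j = r" "l \<le> r - 1" "r - 1 \<le> r" "r - 1 \<noteq> r"
        using ij \<open>l < r\<close> by auto
      moreover have "monotone_segment w (r - 1) r"
      proof -
        have "{r - 1..<r} = {r - 1}"
          using \<open>l < r\<close> by auto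
        then show ?thesis
          using \<open>l < r\<close> by (simp add: seg)
      qed
      ultimately show False
        using maximal[of "r - 1" r] by blast
    qed
    moreover have "i < j"
    proof (rule ccontr)
      assume "\<not> i < j"
      then have "j = i" using ij by auto
      moreover have "monotone_segment w i (Suc i)"
        using \<open>i < r\<close> ij by (simp add: seg)
      ultimately show False
        using maximal[of i "Suc i"] \<open>i < r\<close> ij by auto
    qed
    moreover have "D (i - 1) \<noteq> D i" if "l < i"
    proof
      assume "D (i - 1) = D i"
      moreover have "\<forall>k\<in>{i..<j}. D k = D i"
        using mono ij seg by blast
      moreover have "k = i - 1 \<or> k \<in> {i..<j}" if "k \<in> {i - 1..<j}" for k
        using that by auto
      ultimately have "\<forall>k\<in>{i - 1..<j}. D k = D (i - 1)"
        by blast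
      moreover have "l \<le> i - 1" "i - 1 \<le> i" "i - 1 \<noteq> i"
        using that by linarith+
      ultimately show False
        using maximal[of "i - 1" j] seg[of "i - 1" j] ij by blast
    qed
    ultimately show "i \<in> starts"
      using ij by (simp add: starts_def)
  next
    fix i assume i: "i \<in> starts"
    \<comment> \<open>The run is the longest monotone segment from \<open>i\<close> to the right; an
      extension to the left would cross the direction change at \<open>i\<close>.\<close>
    define J where "J = {j. i < j \<and> j \<le> r \<and> monotone_segment w i j}"
    have "finite J"
      by (rule finite_subset[of _ "{..r}"]) (auto simp: J_def)
    moreover have "Suc i \<in> J"
      using i by (auto simp: J_def starts_def seg)
    ultimately have j: "Max J \<in> J" and j_max: "\<And>j. j \<in> J \<Longrightarrow> j \<le> Max J"
      using Max_in Max_ge by blast+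
    have "(i, Max J) \<in> maximal_runs l r w"
      unfolding maximal_runs_def
    proof (clarify, intro conjI allI impI)
      show "l \<le> i" "i \<le> Max J" "Max J \<le> r" "monotone_segment w i (Max J)"
        using i j by (auto simp: J_def starts_def)
      fix i' j'
      assume a: "l \<le> i' \<and> i' \<le> i \<and> Max J \<le> j' \<and> j' \<le> r \<and> monotone_segment w i' j'"
      have "i < j'"
        using a j by (auto simp: J_def)
      show i': "i' = i"
      proof (rule ccontr)
        assume "i' \<noteq> i"
        then have "i' < i" using a by simp
        moreover have "\<forall>k\<in>{i'..<j'}. D k = D i'"
          using a seg by blast
        moreover have "i - 1 \<in> {i'..<j'}" "i \<in> {i'..<j'}" "l < i"
          using \<open>i < j'\<close> \<open>i' < i\<close> a by auto
        ultimately show False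
          using i unfolding starts_def by blast
      qed
      then have "j' \<in> J"
        using a \<open>i < j'\<close> by (simp add: J_def)
      then show "j' = Max J"
        using j_max a by (simp add: le_antisym)
    qed
    then show "i \<in> fst ` maximal_runs l r w"
      by force
  qed
  ultimately have "card (maximal_runs l r w) = card starts"
    using card_image by fastforce
  \<comment> \<open>The start \<open>Suc (l + j)\<close> belongs to the change between the
    directions at \<open>l + j\<close> and \<open>Suc (l + j)\<close>.\<close>
  also have "starts = insert l ((\<lambda>j. Suc (l + j)) ` {j. j < r - l - 1 \<and> D (l + j) \<noteq> D (Suc (l + j))})"
  proof (intro subset_antisym subsetI)
    fix i assume i: "i \<in> starts"
    show "i \<in> insert l ((\<lambda>j. Suc (l + j)) ` {j. j < r - l - 1 \<and> D (l + j) \<noteq> D (Suc (l + j))})"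
    proof (cases "i = l")
      case False
      then obtain j where "i = Suc (l + j)"
        using i less_imp_Suc_add[of l i] by (auto simp: starts_def)
      then show ?thesis
        using i by (auto simp: starts_def)
    qed simp
  qed (use \<open>l < r\<close> in \<open>auto simp: starts_def\<close>)
  also have "card \<dots> = Suc (card {j. j < r - l - 1 \<and> D (l + j) \<noteq> D (Suc (l + j))})"
    by (subst card_insert_disjoint) (auto simp: card_image inj_on_def)
  also have "card {j. j < r - l - 1 \<and> D (l + j) \<noteq> D (Suc (l + j))}
      = flips (\<lambda>j. D (l + j)) (r - l - 1)"
    by (simp add: flips_def sum_of_bool_eq Int_def)
  finally show ?thesis
    by (simp add: D_def)
qed

text \<open>
  The initial direction is ascending (as for left runs, with \<open>\<sigma>\<^sub>0 = 0\<close>) for \<open>a = 0\<close> and descending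
  for \<open>a = 1\<close>.
\<close>

definition dir :: "nat \<Rightarrow> (nat \<Rightarrow> nat) \<Rightarrow> nat \<Rightarrow> bool" where
  "dir a \<sigma> j = (if j = 0 then even a else \<sigma> j < \<sigma> (Suc j))"

definition dir_flips :: "nat \<Rightarrow> nat \<Rightarrow> (nat \<Rightarrow> nat) \<Rightarrow> nat" where
  "dir_flips n a \<sigma> = flips (dir a \<sigma>) (n - 1)"

section \<open>Runs and peaks as direction changes\<close>

lemma sym_perms_neq:
  assumes "\<sigma> \<in> sym_perms n"
  shows "\<sigma> k \<noteq> \<sigma> (Suc k)"
proof -
  have "inj \<sigma>"
    using assms by (auto simp: sym_perms_def permutes_inj)
  then show ?thesis
    by (simp add: inj_eq)
qed

lemma sym_perms_0:
  assumes "\<sigma> \<in> sym_perms n"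
  shows "\<sigma> 0 = 0"
  using assms permutes_not_in[of \<sigma> "{1..n}" 0] by (simp add: sym_perms_def)

lemma dir_0:
  assumes "\<sigma> \<in> sym_perms n"
  shows "dir 0 \<sigma> = (\<lambda>j. \<sigma> j < \<sigma> (Suc j))"
  using sym_perms_0[OF assms] sym_perms_neq[OF assms, of 0] by (simp add: dir_def fun_eq_iff)

lemma left_run_eq:
  assumes "2 \<le> n" "\<sigma> \<in> sym_perms n"
  shows "left_run n \<sigma> = Suc (dir_flips n 0 \<sigma>)"
  unfolding left_run_def dir_flips_def dir_0[OF assms(2)]
  using card_maximal_runs[of 0 n \<sigma>] sym_perms_neq[OF assms(2)] assms(1) by simp

lemma run_eq:
  assumes "2 \<le> n" "\<sigma> \<in> sym_perms n"
  shows "run n \<sigma> = Suc (flips (\<lambda>j. \<sigma> (Suc j) < \<sigma> (Suc (Suc j))) (n - 2))"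
  unfolding run_def
  using card_maximal_runs[of 1 n \<sigma>] sym_perms_neq[OF assms(2)] assms(1) by (simp add: numeral_2_eq_2)

lemma flips_Suc_shift: "flips d (Suc N) = of_bool (d 0 \<noteq> d 1) + flips (\<lambda>j. d (Suc j)) N"
  unfolding flips_def by (subst sum.lessThan_Suc_shift) simp

lemma dir_flips_eq_run:
  assumes "2 \<le> n" "\<sigma> \<in> sym_perms n"
  shows "Suc (dir_flips n a \<sigma>) = run n \<sigma> + of_bool (even a \<noteq> (\<sigma> 1 < \<sigma> 2))"
proof -
  have "n - 1 = Suc (n - 2)"
    using assms(1) by simp
  then show ?thesis
    unfolding dir_flips_def run_eq[OF assms] by (simp add: flips_Suc_shift dir_def numeral_2_eq_2)
qed

lemma run_bounds:
  assumes "2 \<le> n" "\<sigma> \<in> sym_perms n"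
  shows "1 \<le> run n \<sigma>" "run n \<sigma> \<le> n - 1"
  using run_eq[OF assms] flips_le[of "\<lambda>j. \<sigma> (Suc j) < \<sigma> (Suc (Suc j))" "n - 2"] assms(1)
  by linarith+

lemma dir_flips_less: "2 \<le> n \<Longrightarrow> dir_flips n a \<sigma> < n"
  unfolding dir_flips_def using flips_le[of "dir a \<sigma>" "n - 1"] by linarith

text \<open>Changes of the two kinds add up to \<open>flips d N\<close>, and they alternate, so that
  \<open>d 0\<close> and \<open>d N\<close> determine the difference of their numbers.\<close>

lemma flips_down:
  "2 * (\<Sum>j<N. of_bool (d j \<and> \<not> d (Suc j))) + of_bool (d N) = flips d N + of_bool (d 0 :: bool)"
proof (induction N)
  case 0
  show ?case by (simp add: flips_def)
next
  case (Suc N)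
  then show ?case
    by (cases "d N"; cases "d (Suc N)") (simp_all add: flips_Suc del: sum_of_bool_eq)
qed

lemma card_descending_flips:
  "card {j. j < N \<and> d j \<and> \<not> d (Suc j)} = (flips d N + of_bool (d 0 :: bool)) div 2"
proof -
  have "card {j. j < N \<and> d j \<and> \<not> d (Suc j)} = (\<Sum>j<N. of_bool (d j \<and> \<not> d (Suc j)))"
    by (simp add: sum_of_bool_eq Int_def)
  then show ?thesis
    using flips_down[of d N] by (cases "d N") simp_all
qed

text \<open>A left peak is a change from ascent to descent. The prepended ascent admits position 1
  and accounts for the \<open>Suc\<close>.\<close>

lemma card_left_peaks:
  assumes "2 \<le> n" "\<sigma> \<in> sym_perms n"
  shows "card (left_peaks n \<sigma>) = Suc (dir_flips n 0 \<sigma>) div 2"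
proof -
  note dir = dir_0[OF assms(2)]
  have "left_peaks n \<sigma> = Suc ` {j. j < n - 1 \<and> dir 0 \<sigma> j \<and> \<not> dir 0 \<sigma> (Suc j)}"
  proof (intro subset_antisym subsetI)
    fix i assume "i \<in> left_peaks n \<sigma>"
    then show "i \<in> Suc ` {j. j < n - 1 \<and> dir 0 \<sigma> j \<and> \<not> dir 0 \<sigma> (Suc j)}"
      by (cases i) (auto simp: left_peaks_def dir)
  next
    fix i assume "i \<in> Suc ` {j. j < n - 1 \<and> dir 0 \<sigma> j \<and> \<not> dir 0 \<sigma> (Suc j)}"
    then show "i \<in> left_peaks n \<sigma>"
      using sym_perms_neq[OF assms(2)] sym_perms_neq[OF assms(2), symmetric]
      by (auto simp: left_peaks_def dir linorder_not_less order_le_less)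
  qed
  then show ?thesis
    by (simp add: card_image card_descending_flips dir_flips_def) (simp add: dir_def)
qed

text \<open>The prepended direction is now a descent, so position 1 cannot count as a peak and
  nothing is added before halving.\<close>

lemma card_peaks:
  assumes "2 \<le> n" "\<sigma> \<in> sym_perms n"
  shows "card (peaks n \<sigma>) = dir_flips n 1 \<sigma> div 2"
proof -
  have "peaks n \<sigma> = Suc ` {j. j < n - 1 \<and> dir 1 \<sigma> j \<and> \<not> dir 1 \<sigma> (Suc j)}"
  proof (intro subset_antisym subsetI)
    fix i assume "i \<in> peaks n \<sigma>"
    then show "i \<in> Suc ` {j. j < n - 1 \<and> dir 1 \<sigma> j \<and> \<not> dir 1 \<sigma> (Suc j)}"
      by (cases i) (auto simp: peaks_def dir_def)
  next
    fix i assume "i \<in> Suc ` {j. j < n - 1 \<and> dir 1 \<sigma> j \<and> \<not> dir 1 \<sigma> (Suc j)}"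
    then show "i \<in> peaks n \<sigma>"
      using sym_perms_neq[OF assms(2)] sym_perms_neq[OF assms(2), symmetric]
      by (auto simp: peaks_def dir_def linorder_not_less order_le_less split: if_splits)
  qed
  then show ?thesis
    by (simp add: card_image card_descending_flips dir_flips_def) (simp add: dir_def)
qed

section \<open>Spans of sorting sums\<close>

lemma lookup_sorting_sum:
  "Poly_Mapping.lookup (sorting_sum n a m) \<sigma> = of_nat (card {w \<in> words n a m. sorting n w = \<sigma>})"
proof -
  have "finite (words n a m)"
    by (simp add: words_def finite_PiE)
  then show ?thesis
    by (simp add: sorting_sum_def lookup_sum lookup_single when_def sum.If_cases Int_def)
qed

lemma lookup_sorting_sum_outside:
  assumes "\<sigma> \<notin> sym_perms n"
  shows "Poly_Mapping.lookup (sorting_sum n a m) \<sigma> = 0"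
proof -
  have "{w \<in> words n a m. sorting n w = \<sigma>} = {}"
    using assms sorting_permutes unfolding sym_perms_def by blast
  then show ?thesis
    unfolding lookup_sorting_sum by (simp only: card.empty of_nat_0)
qed

lemma prec_iff_step_ok:
  assumes "\<sigma> \<in> sym_perms n" "0 < j"
  shows "prec w (\<sigma> j) (\<sigma> (Suc j)) \<longleftrightarrow> step_ok (dir a \<sigma> j) ((w \<circ> \<sigma>) j) ((w \<circ> \<sigma>) (Suc j))"
  using sym_perms_neq[OF assms(1), of j] assms(2) by (auto simp: prec_def step_ok_def dir_def)

text \<open>\<open>w \<circ> \<sigma>\<close> lists the letters of \<open>w\<close> in sorted order,
  and composing with the inverse of \<open>\<sigma>\<close> recovers \<open>w\<close>.\<close>

lemma card_sorting_eq:
  assumes \<sigma>: "\<sigma> \<in> sym_perms n"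
  shows "card {w \<in> words n a m. sorting n w = \<sigma>}
    = card {f \<in> words n a m. \<forall>j\<in>{1..<n}. step_ok (dir a \<sigma> j) (f j) (f (Suc j))}"
proof (rule bij_betw_same_card[where f = "\<lambda>w. w \<circ> \<sigma>"], rule bij_betw_byWitness[where f' = "\<lambda>f. f \<circ> inv \<sigma>"])
  have perm: "\<sigma> permutes {1..n}"
    using \<sigma> by (simp add: sym_perms_def)
  have iff: "sorting n w = \<sigma> \<longleftrightarrow>
      (\<forall>j\<in>{1..<n}. step_ok (dir a \<sigma> j) ((w \<circ> \<sigma>) j) ((w \<circ> \<sigma>) (Suc j)))" for w
    unfolding sorting_eq_iff[OF perm] using prec_iff_step_ok[OF \<sigma>]
    by (intro ball_cong) auto
  show "(\<lambda>w. w \<circ> \<sigma>) ` {w \<in> words n a m. sorting n w = \<sigma>}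
      \<subseteq> {f \<in> words n a m. \<forall>j\<in>{1..<n}. step_ok (dir a \<sigma> j) (f j) (f (Suc j))}"
    using words_comp_permutes[OF perm] iff by blast
  have inv: "f \<circ> inv \<sigma> \<circ> \<sigma> = f" "f \<circ> \<sigma> \<circ> inv \<sigma> = f" for f :: "nat \<Rightarrow> nat"
    using permutes_inverses[OF perm] by (simp_all add: fun_eq_iff)
  show "\<forall>w\<in>{w \<in> words n a m. sorting n w = \<sigma>}. w \<circ> \<sigma> \<circ> inv \<sigma> = w"
    "\<forall>f\<in>{f \<in> words n a m. \<forall>j\<in>{1..<n}. step_ok (dir a \<sigma> j) (f j) (f (Suc j))}. f \<circ> inv \<sigma> \<circ> \<sigma> = f"
    using inv by blast+
  show "(\<lambda>f. f \<circ> inv \<sigma>) ` {f \<in> words n a m. \<forall>j\<in>{1..<n}. step_ok (dir a \<sigma> j) (f j) (f (Suc j))}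
      \<subseteq> {w \<in> words n a m. sorting n w = \<sigma>}"
  proof clarify
    fix f assume "f \<in> words n a m" "\<forall>j\<in>{1..<n}. step_ok (dir a \<sigma> j) (f j) (f (Suc j))"
    then show "f \<circ> inv \<sigma> \<in> words n a m \<and> sorting n (f \<circ> inv \<sigma>) = \<sigma>"
      unfolding iff inv using words_comp_permutes[OF permutes_inv[OF perm]] by blast
  qed
qed

text \<open>Letter paths are bounded only from below; since they increase weakly, a bound on the
  last letter bounds all letters.\<close>

lemma step_ok_words_eq_paths:
  "{f \<in> words (Suc N) a (Suc L). \<forall>j\<in>{1..<Suc N}. step_ok (d j) (f j) (f (Suc j))}
     = (\<Union>z\<in>{..a + L}. letter_paths a d N z)"
proof (intro subset_antisym subsetI)
  fix f assume "f \<in> {f \<in> words (Suc N) a (Suc L). \<forall>j\<in>{1..<Suc N}. step_ok (d j) (f j) (f (Suc j))}"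
  then have "f \<in> letter_paths a d N (f (Suc N))" "f (Suc N) \<le> a + L"
    unfolding words_def letter_paths_def by (auto simp: PiE_iff less_Suc_eq_le)
  then show "f \<in> (\<Union>z\<in>{..a + L}. letter_paths a d N z)"
    by blast
next
  fix f assume "f \<in> (\<Union>z\<in>{..a + L}. letter_paths a d N z)"
  then have f: "f \<in> {1..Suc N} \<rightarrow>\<^sub>E {a..}" "\<forall>j\<in>{1..<Suc N}. step_ok (d j) (f j) (f (Suc j))"
    "f (Suc N) \<le> a + L"
    unfolding letter_paths_def by auto
  then have "\<forall>j\<in>{1..<Suc N}. f j \<le> f (Suc j)"
    by (auto simp: step_ok_def)
  then have mono: "monotone_on {1..Suc N} (<) (\<le>) f"
    using monotone_on_interval_iff[of "(\<le>)" 1 "Suc N" f] by simp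
  have "f j \<le> f (Suc N)" if "j \<in> {1..Suc N}" for j
    using that monotone_onD[OF mono that, of "Suc N"] by (cases "j = Suc N") auto
  then have "f j \<le> a + L" if "j \<in> {1..Suc N}" for j
    using f(3) that order_trans by blast
  then show "f \<in> {f \<in> words (Suc N) a (Suc L). \<forall>j\<in>{1..<Suc N}. step_ok (d j) (f j) (f (Suc j))}"
    using f unfolding words_def by (auto simp: PiE_iff less_Suc_eq_le)
qed

lemma lookup_sorting_sum_eq:
  assumes "2 \<le> n" and \<sigma>: "\<sigma> \<in> sym_perms n"
  shows "Poly_Mapping.lookup (sorting_sum n a (Suc L)) \<sigma>
    = fps_nth (coef_fps n (dir_flips n a \<sigma>)) L + fps_nth (coef_fps n (Suc (dir_flips n a \<sigma>))) L"
proof -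
  obtain N where N: "n = Suc N"
    using assms(1) by (cases n) auto
  let ?d = "dir a \<sigma>"
  have "card {w \<in> words n a (Suc L). sorting n w = \<sigma>} = card (\<Union>z\<in>{..a + L}. letter_paths a ?d N z)"
    unfolding card_sorting_eq[OF \<sigma>] unfolding N step_ok_words_eq_paths ..
  also have "\<dots> = (\<Sum>z\<le>a + L. card (letter_paths a ?d N z))"
    by (rule card_UN_disjoint) (simp_all add: finite_letter_paths, auto simp: letter_paths_def)
  finally show ?thesis
    using sum_paths_eq[of ?d a N L]
    by (simp add: lookup_sorting_sum dir_flips_def N dir_def[of _ _ 0])
qed

lemma sorting_sum_expansion:
  fixes stat :: "(nat \<Rightarrow> nat) \<Rightarrow> nat" and t :: "nat \<Rightarrow> rat"
  assumes "\<And>\<sigma>. \<sigma> \<in> sym_perms n \<Longrightarrow> Poly_Mapping.lookup (sorting_sum n a m) \<sigma> = t (stat \<sigma>)"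
    and "\<And>\<sigma>. \<sigma> \<in> sym_perms n \<Longrightarrow> stat \<sigma> \<le> N"
  shows "sorting_sum n a m = (\<Sum>j\<le>N. pa_scale (t j) (class_sum n (\<lambda>\<sigma>. stat \<sigma> = j)))"
proof (rule poly_mapping_eqI)
  fix \<sigma>
  show "Poly_Mapping.lookup (sorting_sum n a m) \<sigma>
      = Poly_Mapping.lookup (\<Sum>j\<le>N. pa_scale (t j) (class_sum n (\<lambda>\<sigma>. stat \<sigma> = j))) \<sigma>"
  proof (cases "\<sigma> \<in> sym_perms n")
    case True
    then have "(\<Sum>j\<le>N. t j * of_bool (stat \<sigma> = j)) = t (stat \<sigma>)"
      using assms(2) by (simp add: of_bool_def if_distrib sum.delta' cong: if_cong)
    with True show ?thesis
      by (simp add: assms(1) lookup_sum lookup_class_sum)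
  next
    case False
    then show ?thesis
      by (simp add: lookup_sorting_sum_outside lookup_sum lookup_class_sum)
  qed
qed

text \<open>Column \<open>j\<close> of the matrix consists of the coefficients of H_j + H_(j+1). The
  second summand starts one degree later, so H_j alone gives the diagonal.\<close>

lemma span_dir_classes:
  assumes "2 \<le> n"
  shows "perm_alg.span (range (\<lambda>i. sorting_sum n a (Suc i)))
    = perm_alg.span ((\<lambda>k. class_sum n (\<lambda>\<sigma>. dir_flips n a \<sigma> = k)) ` {0..n - 1})"
proof (rule span_triangular)
  fix i
  have "dir_flips n a \<sigma> \<le> n - 1" for \<sigma>
    using dir_flips_less[OF assms, of a \<sigma>] by linarith
  then show "sorting_sum n a (Suc i) = (\<Sum>j\<le>n - 1.
      pa_scale (fps_nth (coef_fps n j) i + fps_nth (coef_fps n (Suc j)) i)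
        (class_sum n (\<lambda>\<sigma>. dir_flips n a \<sigma> = j)))"
    by (intro sorting_sum_expansion lookup_sorting_sum_eq assms)
next
  fix i j :: nat assume "i < j"
  then show "fps_nth (coef_fps n j) i + fps_nth (coef_fps n (Suc j)) i = 0"
    by (simp add: coef_fps_below)
next
  fix j
  show "fps_nth (coef_fps n j) j + fps_nth (coef_fps n (Suc j)) j \<noteq> 0"
    using coef_fps_diag[of n j] by (simp add: coef_fps_below)
qed

lemma coef_fps_parity: "even q \<noteq> even L \<Longrightarrow> fps_nth (coef_fps n q) L = 0"
  using has_parity_coef[of q n] by (auto simp: has_parity_def)

section \<open>The spaces as spans of sorting sums\<close>

lemma W_left_space_eq:
  assumes "2 \<le> n"
  shows "W_left_space n = perm_alg.span (range (\<lambda>i. sorting_sum n 0 (Suc i)))"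
proof -
  have "W_left n (Suc k) = class_sum n (\<lambda>\<sigma>. dir_flips n 0 \<sigma> = k)" for k
    unfolding W_left_def using left_run_eq[OF assms] by (intro class_sum_cong) simp
  then have "(\<lambda>k. class_sum n (\<lambda>\<sigma>. dir_flips n 0 \<sigma> = k)) ` {0..n - 1} = W_left n ` Suc ` {0..n - 1}"
    unfolding image_image by (intro image_cong refl) simp
  also have "Suc ` {0..n - 1} = {1..n}"
    using assms by (simp add: image_Suc_atLeastAtMost)
  finally show ?thesis
    by (simp add: W_left_space_def span_dir_classes[OF assms])
qed

text \<open>The coefficient is taken at the odd degree \<open>2 * i + 1\<close>, so of H_k and
  H_(k+1) only the one with odd index contributes. That index is \<open>Suc (2 * (k div 2))\<close>,
  and \<open>k div 2\<close> is the number of peaks.\<close>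

lemma P_space_eq:
  assumes "2 \<le> n"
  shows "P_space n = perm_alg.span (range (\<lambda>i. sorting_sum n 1 (2 * Suc i)))"
  unfolding P_space_def
proof (rule span_triangular[symmetric])
  fix i
  show "sorting_sum n 1 (2 * Suc i) = (\<Sum>j\<le>(n - 1) div 2.
      pa_scale (fps_nth (coef_fps n (Suc (2 * j))) (Suc (2 * i))) (P_int n j))"
    unfolding P_int_def
  proof (rule sorting_sum_expansion)
    fix \<sigma> assume \<sigma>: "\<sigma> \<in> sym_perms n"
    show "card (peaks n \<sigma>) \<le> (n - 1) div 2"
      unfolding card_peaks[OF assms \<sigma>] using dir_flips_less[OF assms, of 1 \<sigma>]
      by (intro div_le_mono) linarith
    have "sorting_sum n 1 (2 * Suc i) = sorting_sum n 1 (Suc (Suc (2 * i)))"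
      by simp
    then show "Poly_Mapping.lookup (sorting_sum n 1 (2 * Suc i)) \<sigma>
        = fps_nth (coef_fps n (Suc (2 * card (peaks n \<sigma>)))) (Suc (2 * i))"
      unfolding card_peaks[OF assms \<sigma>]
      by (cases "even (dir_flips n 1 \<sigma>)")
        (simp_all only: lookup_sorting_sum_eq[OF assms \<sigma>], auto simp: coef_fps_parity elim!: evenE oddE)
  qed
qed (simp_all add: coef_fps_below coef_fps_diag)

text \<open>At the even degree \<open>2 * i\<close> the even one of the indices k and k + 1
  survives, which is twice \<open>Suc k div 2\<close>, the number of left peaks.\<close>

lemma P_left_space_eq:
  assumes "2 \<le> n"
  shows "P_left_space n = perm_alg.span (range (\<lambda>i. sorting_sum n 0 (Suc (2 * i))))"
  unfolding P_left_space_def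
proof (rule span_triangular[symmetric])
  fix i
  show "sorting_sum n 0 (Suc (2 * i)) = (\<Sum>j\<le>n div 2.
      pa_scale (fps_nth (coef_fps n (2 * j)) (2 * i)) (P_left n j))"
    unfolding P_left_def
  proof (rule sorting_sum_expansion)
    fix \<sigma> assume \<sigma>: "\<sigma> \<in> sym_perms n"
    show "card (left_peaks n \<sigma>) \<le> n div 2"
      unfolding card_left_peaks[OF assms \<sigma>] using dir_flips_less[OF assms, of 0 \<sigma>]
      by (intro div_le_mono) linarith
    show "Poly_Mapping.lookup (sorting_sum n 0 (Suc (2 * i))) \<sigma>
        = fps_nth (coef_fps n (2 * card (left_peaks n \<sigma>))) (2 * i)"
      unfolding card_left_peaks[OF assms \<sigma>] lookup_sorting_sum_eq[OF assms \<sigma>]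
      by (cases "even (dir_flips n 0 \<sigma>)") (auto simp: coef_fps_parity elim!: evenE oddE)
  qed
qed (simp_all add: coef_fps_below coef_fps_diag)

text \<open>These boundary values start the recursion on \<open>k\<close> in
  \<open>W_pm_space_eq\<close> and cover the index \<open>n\<close> reached in
  \<open>dir_class_eq_W\<close>.\<close>

lemma W_zero:
  assumes "2 \<le> n" "k = 0 \<or> n \<le> k"
  shows "W_plus n k = 0" "W_minus n k = 0"
  using run_bounds[OF assms(1)] assms
  by (fastforce intro!: poly_mapping_eqI simp: W_plus_def W_minus_def lookup_class_sum)+

text \<open>The prepended direction adds a flip exactly when it differs from the first step;
  \<open>run\<close> is then \<open>k\<close>, and otherwise \<open>k + 1\<close>.\<close>

lemma dir_class_eq_W:
  assumes "2 \<le> n"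
  shows "class_sum n (\<lambda>\<sigma>. dir_flips n 0 \<sigma> = k) = W_plus n (Suc k) + W_minus n k" (is "?L0 = ?R0")
    and "class_sum n (\<lambda>\<sigma>. dir_flips n 1 \<sigma> = k) = W_minus n (Suc k) + W_plus n k" (is "?L1 = ?R1")
proof -
  have "Poly_Mapping.lookup ?L0 \<sigma> = Poly_Mapping.lookup ?R0 \<sigma>
      \<and> Poly_Mapping.lookup ?L1 \<sigma> = Poly_Mapping.lookup ?R1 \<sigma>" for \<sigma>
  proof (cases "\<sigma> \<in> sym_perms n")
    case True
    have "\<sigma> 1 \<noteq> \<sigma> 2"
      using sym_perms_neq[OF True, of 1] by (simp add: numeral_2_eq_2)
    then consider "\<sigma> 1 < \<sigma> 2" "\<not> \<sigma> 2 < \<sigma> 1" | "\<sigma> 2 < \<sigma> 1" "\<not> \<sigma> 1 < \<sigma> 2"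
      by linarith
    then show ?thesis
      using dir_flips_eq_run[OF assms True, of 0] dir_flips_eq_run[OF assms True, of 1]
      by cases (simp_all add: W_plus_def W_minus_def lookup_class_sum lookup_add True of_bool_def)
  qed (simp add: W_plus_def W_minus_def lookup_class_sum lookup_add)
  then show "?L0 = ?R0" "?L1 = ?R1"
    by (blast intro: poly_mapping_eqI)+
qed

definition sorting_sums :: "nat \<Rightarrow> perm_alg set" where
  "sorting_sums n = {sorting_sum n a (Suc i) | a i. a \<le> 1}"

lemma W_in_W_pm:
  assumes "2 \<le> n"
  shows "W_plus n k \<in> W_pm_space n" "W_minus n k \<in> W_pm_space n"
proof -
  have "W_plus n k \<in> W_pm_space n \<and> W_minus n k \<in> W_pm_space n"
  proof (cases "k \<in> {1..n - 1}")
    case True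
    then show ?thesis
      unfolding W_pm_space_def by (blast intro: perm_alg.span_base)
  next
    case False
    then have "k = 0 \<or> n \<le> k"
      by auto
    then show ?thesis
      using W_zero[OF assms] by (simp add: W_pm_space_def perm_alg.span_zero)
  qed
  then show "W_plus n k \<in> W_pm_space n" "W_minus n k \<in> W_pm_space n"
    by blast+
qed

lemma W_pm_space_eq:
  assumes "2 \<le> n"
  shows "W_pm_space n = perm_alg.span (sorting_sums n)"
proof (rule subset_antisym)
  let ?V = "perm_alg.span (sorting_sums n)"
  have dir_in: "class_sum n (\<lambda>\<sigma>. dir_flips n a \<sigma> = k) \<in> ?V" if "a \<le> 1" "k \<le> n - 1" for a k
  proof -
    have "class_sum n (\<lambda>\<sigma>. dir_flips n a \<sigma> = k)
        \<in> perm_alg.span ((\<lambda>k. class_sum n (\<lambda>\<sigma>. dir_flips n a \<sigma> = k)) ` {0..n - 1})"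
      using that(2) by (intro perm_alg.span_base) auto
    also have "\<dots> = perm_alg.span (range (\<lambda>i. sorting_sum n a (Suc i)))"
      by (rule span_dir_classes[OF assms, symmetric])
    also have "\<dots> \<subseteq> ?V"
      using that(1) by (intro perm_alg.span_mono) (auto simp: sorting_sums_def)
    finally show ?thesis .
  qed
  \<comment> \<open>Recursion on \<open>k\<close>: by \<open>dir_class_eq_W\<close> a generator of
    index \<open>Suc k\<close> is a class minus the generator of index \<open>k\<close> with the
    opposite sign.\<close>
  have "W_plus n k \<in> ?V \<and> W_minus n k \<in> ?V" if "k \<le> n - 1" for k
    using that
  proof (induction k)
    case 0
    show ?case
      using W_zero[OF assms] by (simp add: perm_alg.span_zero)
  next
    case (Suc k)
    then have "k \<le> n - 1"
      by simp
    then have "class_sum n (\<lambda>\<sigma>. dir_flips n 0 \<sigma> = k) - W_minus n k \<in> ?V"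
      "class_sum n (\<lambda>\<sigma>. dir_flips n 1 \<sigma> = k) - W_plus n k \<in> ?V"
      using Suc.IH dir_in[of 0 k] dir_in[of 1 k] by (auto intro: perm_alg.span_diff)
    then show ?case
      unfolding dir_class_eq_W[OF assms] by simp
  qed
  then show "W_pm_space n \<subseteq> ?V"
    unfolding W_pm_space_def by (intro perm_alg.span_minimal perm_alg.subspace_span) auto
next
  have sub: "perm_alg.subspace (W_pm_space n)"
    by (simp add: W_pm_space_def perm_alg.subspace_span)
  have "sorting_sum n a (Suc i) \<in> W_pm_space n" if "a \<le> 1" for a i
  proof -
    have "class_sum n (\<lambda>\<sigma>. dir_flips n a \<sigma> = k) \<in> W_pm_space n" for k
      using that W_in_W_pm[OF assms] perm_alg.subspace_add[OF sub] dir_class_eq_W[OF assms, of k]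
      by (cases "a = 0") (auto simp: le_Suc_eq)
    then have "perm_alg.span ((\<lambda>k. class_sum n (\<lambda>\<sigma>. dir_flips n a \<sigma> = k)) ` {0..n - 1}) \<subseteq> W_pm_space n"
      by (intro perm_alg.span_minimal sub) auto
    moreover have "sorting_sum n a (Suc i) \<in> perm_alg.span (range (\<lambda>i. sorting_sum n a (Suc i)))"
      by (intro perm_alg.span_base) auto
    ultimately show ?thesis
      unfolding span_dir_classes[OF assms] by blast
  qed
  then show "perm_alg.span (sorting_sums n) \<subseteq> W_pm_space n"
    by (intro perm_alg.span_minimal sub) (auto simp: sorting_sums_def)
qed

section \<open>Subalgebras spanned by sorting sums\<close>

lemma subalgebra_span_sorting_sums:
  assumes "2 \<le> n" "S \<subseteq> sorting_sums n"
    and "\<And>x y. x \<in> S \<Longrightarrow> y \<in> S \<Longrightarrow> pa_mult x y \<in> S"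
  shows "subalgebra_of (perm_alg.span S) (W_pm_space n)"
  unfolding subalgebra_of_def W_pm_space_eq[OF assms(1)]
proof (intro conjI ballI perm_alg.span_mono assms(2) perm_alg.subspace_span)
  fix x y assume "x \<in> perm_alg.span S" "y \<in> perm_alg.span S"
  then show "pa_mult x y \<in> perm_alg.span S"
    by (rule span_mult_closed[rotated]) (blast intro: perm_alg.span_base assms(3))
qed

lemma sorting_sums_mult:
  assumes "x \<in> sorting_sums n" "y \<in> sorting_sums n"
  shows "pa_mult x y \<in> sorting_sums n"
proof -
  obtain a i b j where ab: "a \<le> 1" "x = sorting_sum n a (Suc i)" "y = sorting_sum n b (Suc j)"
    using assms unfolding sorting_sums_def by blast
  have "pa_mult x y = sorting_sum n (pair_origin a (Suc i) b) (Suc (j * Suc i + i))"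
    by (simp add: ab sorting_sum_mult algebra_simps)
  moreover have "pair_origin a (Suc i) b \<le> 1"
  proof -
    have "(a + b) mod 2 < 2"
      by simp
    then have "(a + b) mod 2 \<le> 1"
      by linarith
    then show ?thesis
      using ab(1) unfolding pair_origin_def by presburger
  qed
  ultimately show ?thesis
    unfolding sorting_sums_def by blast
qed

lemma W_left_subalgebra:
  assumes "2 \<le> n"
  shows "subalgebra_of (W_left_space n) (W_pm_space n)"
  unfolding W_left_space_eq[OF assms]
proof (rule subalgebra_span_sorting_sums[OF assms])
  show "range (\<lambda>i. sorting_sum n 0 (Suc i)) \<subseteq> sorting_sums n"
    by (auto simp: sorting_sums_def)
  fix x y assume "x \<in> range (\<lambda>i. sorting_sum n 0 (Suc i))" "y \<in> range (\<lambda>i. sorting_sum n 0 (Suc i))"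
  then obtain i j where "x = sorting_sum n 0 (Suc i)" "y = sorting_sum n 0 (Suc j)"
    by blast
  moreover have "Suc j * Suc i = Suc (j * Suc i + i)"
    by simp
  moreover have "pair_origin 0 (Suc i) 0 = 0"
    by (simp add: pair_origin_def)
  ultimately have "pa_mult x y = sorting_sum n 0 (Suc (j * Suc i + i))"
    by (simp only: sorting_sum_mult)
  then show "pa_mult x y \<in> range (\<lambda>i. sorting_sum n 0 (Suc i))"
    by blast
qed

text \<open>Even alphabet sizes are closed under multiplication, and an even size of the first
  factor preserves the origin 1, whereas an odd one would give
  \<open>(1 + 1) mod 2 = 0\<close>.\<close>

lemma P_subalgebra:
  assumes "2 \<le> n"
  shows "subalgebra_of (P_space n) (W_pm_space n)"
  unfolding P_space_eq[OF assms]
proof (rule subalgebra_span_sorting_sums[OF assms])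
  have "2 * Suc i = Suc (Suc (2 * i))" for i
    by simp
  then show "range (\<lambda>i. sorting_sum n 1 (2 * Suc i)) \<subseteq> sorting_sums n"
    unfolding sorting_sums_def by fastforce
  fix x y assume "x \<in> range (\<lambda>i. sorting_sum n 1 (2 * Suc i))" "y \<in> range (\<lambda>i. sorting_sum n 1 (2 * Suc i))"
  then obtain i j where "x = sorting_sum n 1 (2 * Suc i)" "y = sorting_sum n 1 (2 * Suc j)"
    by blast
  moreover have "2 * Suc j * (2 * Suc i) = 2 * Suc (2 * j * Suc i + 2 * i + 1)"
    by simp
  moreover have "pair_origin 1 (2 * Suc i) 1 = 1"
    by (simp add: pair_origin_def)
  ultimately have "pa_mult x y = sorting_sum n 1 (2 * Suc (2 * j * Suc i + 2 * i + 1))"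
    by (simp only: sorting_sum_mult)
  then show "pa_mult x y \<in> range (\<lambda>i. sorting_sum n 1 (2 * Suc i))"
    by blast
qed

lemma P_left_subalgebra:
  assumes "2 \<le> n"
  shows "subalgebra_of (P_left_space n) (W_pm_space n)"
  unfolding P_left_space_eq[OF assms]
proof (rule subalgebra_span_sorting_sums[OF assms])
  show "range (\<lambda>i. sorting_sum n 0 (Suc (2 * i))) \<subseteq> sorting_sums n"
    by (auto simp: sorting_sums_def)
  fix x y assume "x \<in> range (\<lambda>i. sorting_sum n 0 (Suc (2 * i)))" "y \<in> range (\<lambda>i. sorting_sum n 0 (Suc (2 * i)))"
  then obtain i j where "x = sorting_sum n 0 (Suc (2 * i))" "y = sorting_sum n 0 (Suc (2 * j))"
    by blast
  moreover have "Suc (2 * j) * Suc (2 * i) = Suc (2 * (2 * j * i + j + i))"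
    by simp
  moreover have "pair_origin 0 (Suc (2 * i)) 0 = 0"
    by (simp add: pair_origin_def)
  ultimately have "pa_mult x y = sorting_sum n 0 (Suc (2 * (2 * j * i + j + i)))"
    by (simp only: sorting_sum_mult)
  then show "pa_mult x y \<in> range (\<lambda>i. sorting_sum n 0 (Suc (2 * i)))"
    by blast
qed

section \<open>The reversing permutation and the subalgebras\<close>

text \<open>The number of runs and the first direction are functions of the descent set. Closure
  under products comes from the sorting sums.\<close>

lemma W_pm_subalgebra:
  assumes "2 \<le> n"
  shows "subalgebra_of (W_pm_space n) (descent_algebra n)"
proof -
  have run_Des: "run n \<sigma> = run n \<tau>" and first_Des: "\<sigma> 1 < \<sigma> 2 \<longleftrightarrow> \<tau> 1 < \<tau> 2" "\<sigma> 2 < \<sigma> 1 \<longleftrightarrow> \<tau> 2 < \<tau> 1"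
    if "\<sigma> \<in> sym_perms n" "\<tau> \<in> sym_perms n" and Des: "Des n \<sigma> = Des n \<tau>" for \<sigma> \<tau>
  proof -
    have desc: "\<sigma> (Suc k) < \<sigma> k \<longleftrightarrow> \<tau> (Suc k) < \<tau> k" if "1 \<le> k" "k < n" for k
    proof -
      have "k \<in> Des n \<sigma> \<longleftrightarrow> k \<in> Des n \<tau>"
        using Des by simp
      then show ?thesis
        using that by (auto simp: Des_def)
    qed
    have asc: "\<sigma> k < \<sigma> (Suc k) \<longleftrightarrow> \<tau> k < \<tau> (Suc k)" if "1 \<le> k" "k < n" for k
      using desc[OF that] sym_perms_neq[OF \<open>\<sigma> \<in> sym_perms n\<close>, of k]
        sym_perms_neq[OF \<open>\<tau> \<in> sym_perms n\<close>, of k] by linarith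
    show "\<sigma> 1 < \<sigma> 2 \<longleftrightarrow> \<tau> 1 < \<tau> 2" "\<sigma> 2 < \<sigma> 1 \<longleftrightarrow> \<tau> 2 < \<tau> 1"
      using asc[of 1] desc[of 1] assms by (simp_all add: numeral_2_eq_2)
    show "run n \<sigma> = run n \<tau>"
      unfolding run_eq[OF assms that(1)] run_eq[OF assms that(2)] flips_def
      by (intro arg_cong[where f = Suc] sum.cong refl) (simp add: asc)
  qed
  have "W_plus n k \<in> descent_algebra n" for k
    unfolding W_plus_def
  proof (rule class_sum_in_descent_algebra)
    fix \<sigma> \<tau> assume "\<sigma> \<in> sym_perms n" "\<tau> \<in> sym_perms n" "Des n \<sigma> = Des n \<tau>" "run n \<sigma> = k \<and> \<sigma> 1 < \<sigma> 2"
    then show "run n \<tau> = k \<and> \<tau> 1 < \<tau> 2"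
      using run_Des[of \<sigma> \<tau>] first_Des(1)[of \<sigma> \<tau>] by simp
  qed
  moreover have "W_minus n k \<in> descent_algebra n" for k
    unfolding W_minus_def
  proof (rule class_sum_in_descent_algebra)
    fix \<sigma> \<tau> assume "\<sigma> \<in> sym_perms n" "\<tau> \<in> sym_perms n" "Des n \<sigma> = Des n \<tau>" "run n \<sigma> = k \<and> \<sigma> 2 < \<sigma> 1"
    then show "run n \<tau> = k \<and> \<tau> 2 < \<tau> 1"
      using run_Des[of \<sigma> \<tau>] first_Des(2)[of \<sigma> \<tau>] by simp
  qed
  ultimately have "W_pm_space n \<subseteq> descent_algebra n"
    unfolding W_pm_space_def descent_algebra_def
    by (intro perm_alg.span_minimal perm_alg.subspace_span) blast
  moreover have "subalgebra_of (W_pm_space n) (W_pm_space n)"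
    using subalgebra_span_sorting_sums[OF assms order_refl sorting_sums_mult] W_pm_space_eq[OF assms]
    by simp
  ultimately show ?thesis
    by (simp add: subalgebra_of_def)
qed

section \<open>The reversing permutation\<close>

definition rev_perm :: "nat \<Rightarrow> nat \<Rightarrow> nat" where
  "rev_perm n i = (if i \<in> {1..n} then Suc n - i else i)"

lemma rev_perm_rev_perm: "rev_perm n (rev_perm n i) = i"
  by (auto simp: rev_perm_def)

lemma rev_perm_permutes: "rev_perm n permutes {1..n}"
  by (rule bij_imp_permutes, rule bij_betw_byWitness[where f' = "rev_perm n"])
    (auto simp: rev_perm_rev_perm, auto simp: rev_perm_def)

text \<open>Left multiplication by \<open>w0 n\<close> complements the values of a permutation,
  right multiplication reverses its word.\<close>

definition w0 :: "nat \<Rightarrow> perm_alg" where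
  "w0 n = Poly_Mapping.single (rev_perm n) 1"

lemma w0_mult_w0: "pa_mult (w0 n) (pa_mult (w0 n) x) = x"
proof -
  have "rev_perm n \<circ> rev_perm n = id"
    by (simp add: fun_eq_iff rev_perm_rev_perm)
  then have "pa_mult (w0 n) (w0 n) = Poly_Mapping.single id 1"
    by (simp add: w0_def pa_mult_single_single)
  moreover have "pa_mult (Poly_Mapping.single id 1) x = x"
    by (induction x rule: poly_mapping_single_add_induct)
      (simp_all add: pa_mult_single_single pa_mult_add_right comp_def)
  ultimately show ?thesis
    by (simp flip: pa_mult_assoc)
qed

lemma sym_perms_comp: "\<sigma> \<in> sym_perms n \<Longrightarrow> \<tau> \<in> sym_perms n \<Longrightarrow> \<sigma> \<circ> \<tau> \<in> sym_perms n"
  by (simp add: sym_perms_def permutes_compose)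

lemma rev_perm_in_sym_perms: "rev_perm n \<in> sym_perms n"
  using rev_perm_permutes by (simp add: sym_perms_def)

lemma w0_mult_class_sum: "pa_mult (w0 n) (class_sum n Q) = class_sum n (\<lambda>\<sigma>. Q (rev_perm n \<circ> \<sigma>))"
  unfolding w0_def class_sum_def pa_mult_sum_right pa_mult_single_single
proof (rule sum.reindex_bij_witness[where i = "\<lambda>\<sigma>. rev_perm n \<circ> \<sigma>" and j = "\<lambda>\<sigma>. rev_perm n \<circ> \<sigma>"])
  fix \<sigma> :: "nat \<Rightarrow> nat"
  show "rev_perm n \<circ> (rev_perm n \<circ> \<sigma>) = \<sigma>"
    by (simp add: fun_eq_iff rev_perm_rev_perm)
  then show "\<sigma> \<in> {\<sigma> \<in> sym_perms n. Q \<sigma>} \<Longrightarrow> rev_perm n \<circ> \<sigma> \<in> {\<sigma> \<in> sym_perms n. Q (rev_perm n \<circ> \<sigma>)}"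
    "\<sigma> \<in> {\<sigma> \<in> sym_perms n. Q (rev_perm n \<circ> \<sigma>)} \<Longrightarrow> rev_perm n \<circ> \<sigma> \<in> {\<sigma> \<in> sym_perms n. Q \<sigma>}"
    using sym_perms_comp[OF rev_perm_in_sym_perms] by auto
qed (simp_all add: fun_eq_iff rev_perm_rev_perm)

lemma class_sum_mult_w0: "pa_mult (class_sum n Q) (w0 n) = class_sum n (\<lambda>\<sigma>. Q (\<sigma> \<circ> rev_perm n))"
  unfolding w0_def class_sum_def pa_mult_sum_left pa_mult_single_single
proof (rule sum.reindex_bij_witness[where i = "\<lambda>\<sigma>. \<sigma> \<circ> rev_perm n" and j = "\<lambda>\<sigma>. \<sigma> \<circ> rev_perm n"])
  fix \<sigma> :: "nat \<Rightarrow> nat"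
  show "\<sigma> \<circ> rev_perm n \<circ> rev_perm n = \<sigma>"
    by (simp add: fun_eq_iff rev_perm_rev_perm)
  then show "\<sigma> \<in> {\<sigma> \<in> sym_perms n. Q \<sigma>} \<Longrightarrow> \<sigma> \<circ> rev_perm n \<in> {\<sigma> \<in> sym_perms n. Q (\<sigma> \<circ> rev_perm n)}"
    "\<sigma> \<in> {\<sigma> \<in> sym_perms n. Q (\<sigma> \<circ> rev_perm n)} \<Longrightarrow> \<sigma> \<circ> rev_perm n \<in> {\<sigma> \<in> sym_perms n. Q \<sigma>}"
    using sym_perms_comp[OF _ rev_perm_in_sym_perms] by auto
qed (simp_all add: fun_eq_iff rev_perm_rev_perm)

lemma sym_perms_range: "\<sigma> \<in> sym_perms n \<Longrightarrow> i \<in> {1..n} \<Longrightarrow> \<sigma> i \<in> {1..n}"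
  using permutes_in_image[of \<sigma> "{1..n}" i] by (simp add: sym_perms_def)

lemma rev_perm_comp_less:
  assumes "\<sigma> \<in> sym_perms n" "i \<in> {1..n}" "j \<in> {1..n}"
  shows "(rev_perm n \<circ> \<sigma>) i < (rev_perm n \<circ> \<sigma>) j \<longleftrightarrow> \<sigma> j < \<sigma> i"
  using sym_perms_range[OF assms(1,2)] sym_perms_range[OF assms(1,3)] by (auto simp: rev_perm_def)

text \<open>Complementing the values inverts every direction, which preserves the changes.\<close>

lemma run_rev_perm_comp:
  assumes "2 \<le> n" "\<sigma> \<in> sym_perms n"
  shows "run n (rev_perm n \<circ> \<sigma>) = run n \<sigma>"
proof -
  have *: "(rev_perm n \<circ> \<sigma>) (Suc j) < (rev_perm n \<circ> \<sigma>) (Suc (Suc j)) \<longleftrightarrow> \<not> \<sigma> (Suc j) < \<sigma> (Suc (Suc j))"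
    if "j \<le> n - 2" for j
    using rev_perm_comp_less[OF assms(2), of "Suc j" "Suc (Suc j)"] that assms(1)
      sym_perms_neq[OF assms(2), of "Suc j"]
    by (auto simp del: comp_apply)
  show ?thesis
    unfolding run_eq[OF assms] run_eq[OF assms(1) sym_perms_comp[OF rev_perm_in_sym_perms assms(2)]]
      flips_def
    by (intro arg_cong[where f = Suc] sum.cong refl) (simp add: * del: comp_apply)
qed

lemma w0_mult_W:
  assumes "2 \<le> n"
  shows "pa_mult (w0 n) (W_plus n k) = W_minus n k" "pa_mult (w0 n) (W_minus n k) = W_plus n k"
proof -
  show "pa_mult (w0 n) (W_plus n k) = W_minus n k"
    unfolding W_plus_def W_minus_def w0_mult_class_sum
    using assms by (intro class_sum_cong) (simp add: run_rev_perm_comp rev_perm_comp_less del: comp_apply)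
  then show "pa_mult (w0 n) (W_minus n k) = W_plus n k"
    by (metis w0_mult_w0)
qed

lemma flips_rev: "flips (\<lambda>j. d (N - j)) N = flips d N"
proof -
  have "flips (\<lambda>j. d (N - j)) N = (\<Sum>j<N. of_bool (d (N - Suc j) \<noteq> d (Suc (N - Suc j))))"
    unfolding flips_def by (intro sum.cong refl) (auto simp: Suc_diff_Suc)
  also have "\<dots> = flips d N"
    unfolding flips_def by (rule sum.nat_diff_reindex)
  finally show ?thesis .
qed

text \<open>Reversing the word and complementing the values each invert directions, so conjugation
  only reverses their order. The first direction of \<open>\<tau>\<close> is the last one of
  \<open>\<sigma>\<close>; it agrees with the first one of \<open>\<sigma>\<close> iff the number of
  changes is even, that is, the number of runs is odd.\<close>

lemma run_first_conj:
  assumes "2 \<le> n" and \<sigma>: "\<sigma> \<in> sym_perms n"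
  defines "\<tau> \<equiv> rev_perm n \<circ> \<sigma> \<circ> rev_perm n"
  shows "run n \<tau> = run n \<sigma>" "\<tau> 1 < \<tau> 2 \<longleftrightarrow> (odd (run n \<sigma>) \<longleftrightarrow> \<sigma> 1 < \<sigma> 2)"
proof -
  let ?N = "n - 2" and ?d = "\<lambda>j. \<sigma> (Suc j) < \<sigma> (Suc (Suc j))"
  have \<tau>: "\<tau> \<in> sym_perms n"
    unfolding \<tau>_def by (intro sym_perms_comp rev_perm_in_sym_perms \<sigma>)
  have dir: "\<tau> (Suc j) < \<tau> (Suc (Suc j)) \<longleftrightarrow> ?d (?N - j)" if "j \<le> ?N" for j
  proof -
    have "\<tau> (Suc j) < \<tau> (Suc (Suc j)) \<longleftrightarrow> \<sigma> (rev_perm n (Suc (Suc j))) < \<sigma> (rev_perm n (Suc j))"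
      using that assms(1) sym_perms_range[OF rev_perm_in_sym_perms, of "Suc j"]
        sym_perms_range[OF rev_perm_in_sym_perms, of "Suc (Suc j)"]
        rev_perm_comp_less[OF \<sigma>, of "rev_perm n (Suc j)" "rev_perm n (Suc (Suc j))"]
      by (simp add: \<tau>_def)
    moreover have "rev_perm n (Suc (Suc j)) = Suc (?N - j)" "rev_perm n (Suc j) = Suc (Suc (?N - j))"
      using that assms(1) by (auto simp: rev_perm_def)
    ultimately show ?thesis
      by simp
  qed
  have "flips (\<lambda>j. \<tau> (Suc j) < \<tau> (Suc (Suc j))) ?N = flips (\<lambda>j. ?d (?N - j)) ?N"
    unfolding flips_def by (intro sum.cong refl) (simp add: dir)
  also have "\<dots> = flips ?d ?N"
    by (rule flips_rev)
  finally show run: "run n \<tau> = run n \<sigma>"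
    by (simp add: run_eq[OF assms(1) \<sigma>] run_eq[OF assms(1) \<tau>])
  have "odd (run n \<sigma>) \<longleftrightarrow> ?d 0 = ?d ?N"
    by (simp add: run_eq[OF assms(1) \<sigma>] even_flips)
  then show "\<tau> 1 < \<tau> 2 \<longleftrightarrow> (odd (run n \<sigma>) \<longleftrightarrow> \<sigma> 1 < \<sigma> 2)"
    using dir[of 0] by (auto simp: numeral_2_eq_2)
qed

section \<open>Conjugation and fixed points\<close>

definition conj_w0 :: "nat \<Rightarrow> perm_alg \<Rightarrow> perm_alg" where
  "conj_w0 n x = pa_mult (w0 n) (pa_mult x (w0 n))"

lemma conj_w0_W_plus:
  assumes "2 \<le> n"
  shows "conj_w0 n (W_plus n k) = (if odd k then W_plus n k else W_minus n k)"
proof -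
  have "run n (rev_perm n \<circ> \<sigma> \<circ> rev_perm n) = k
      \<and> (rev_perm n \<circ> \<sigma> \<circ> rev_perm n) 1 < (rev_perm n \<circ> \<sigma> \<circ> rev_perm n) 2
    \<longleftrightarrow> run n \<sigma> = k \<and> (if odd k then \<sigma> 1 < \<sigma> 2 else \<sigma> 2 < \<sigma> 1)" if "\<sigma> \<in> sym_perms n" for \<sigma>
  proof -
    have "\<sigma> 2 < \<sigma> 1 \<longleftrightarrow> \<not> \<sigma> 1 < \<sigma> 2"
      using sym_perms_neq[OF that, of 1] by (auto simp: numeral_2_eq_2)
    then show ?thesis
      unfolding run_first_conj[OF assms that] by auto
  qed
  then have "conj_w0 n (W_plus n k)
      = class_sum n (\<lambda>\<sigma>. run n \<sigma> = k \<and> (if odd k then \<sigma> 1 < \<sigma> 2 else \<sigma> 2 < \<sigma> 1))"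
    unfolding conj_w0_def W_plus_def class_sum_mult_w0 w0_mult_class_sum by (rule class_sum_cong)
  then show ?thesis
    by (simp add: W_plus_def W_minus_def)
qed

lemma conj_w0_conj_w0: "conj_w0 n (conj_w0 n x) = x"
proof -
  have "pa_mult (pa_mult x (w0 n)) (w0 n) = x" for x
  proof (induction x rule: poly_mapping_single_add_induct)
    case (single \<sigma> c)
    have "\<sigma> \<circ> rev_perm n \<circ> rev_perm n = \<sigma>"
      by (simp add: fun_eq_iff rev_perm_rev_perm)
    then show ?case
      by (simp add: w0_def pa_mult_single_single)
  qed (simp_all add: pa_mult_add_left)
  then show ?thesis
    by (simp add: conj_w0_def pa_mult_assoc[of "w0 n" "pa_mult x (w0 n)"] w0_mult_w0)
qed

text \<open>
  A fixed point \<open>z\<close> of \<open>T\<close> equals \<open>(z + T z) / 2\<close>, so it suffices to symmetrize generators.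
\<close>

lemma fixed_points_subalgebra:
  assumes add: "\<And>x y. T (x + y) = T x + T y" and scale: "\<And>c x. T (pa_scale c x) = pa_scale c (T x)"
    and mult: "\<And>x y. T x = x \<Longrightarrow> T y = y \<Longrightarrow> T (pa_mult x y) = pa_mult x y"
    and closed: "\<And>x y. x \<in> perm_alg.span G \<Longrightarrow> y \<in> perm_alg.span G \<Longrightarrow> pa_mult x y \<in> perm_alg.span G"
    and H: "H \<subseteq> perm_alg.span G" "\<And>h. h \<in> H \<Longrightarrow> T h = h"
    and symmetrized: "\<And>g. g \<in> G \<Longrightarrow> g + T g \<in> perm_alg.span H"
  shows "subalgebra_of (perm_alg.span H) (perm_alg.span G)"
proof -
  have sub: "perm_alg.span H \<subseteq> perm_alg.span G"
    by (rule perm_alg.span_minimal[OF H(1) perm_alg.subspace_span])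
  have zero: "T 0 = 0"
    using add[of 0 0] by simp
  have fixed: "T x = x" if "x \<in> perm_alg.span H" for x
    using that by (induction rule: perm_alg.span_induct_alt) (simp_all add: zero add scale H(2))
  have sym: "z + T z \<in> perm_alg.span H" if "z \<in> perm_alg.span G" for z
    using that
  proof (induction rule: perm_alg.span_induct_alt)
    case base
    show ?case by (simp add: zero perm_alg.span_zero)
  next
    case (step c g z)
    have "pa_scale c g + z + T (pa_scale c g + z) = pa_scale c (g + T g) + (z + T z)"
      by (simp add: add scale perm_alg.scale_right_distrib algebra_simps)
    also have "\<dots> \<in> perm_alg.span H"
      by (rule perm_alg.span_add[OF perm_alg.span_scale[OF symmetrized[OF step(1)]] step(2)])
    finally show ?case .
  qed
  have "pa_mult x y \<in> perm_alg.span H" if "x \<in> perm_alg.span H" "y \<in> perm_alg.span H" for x y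
  proof -
    let ?z = "pa_mult x y"
    have "T ?z = ?z"
      using that by (intro mult fixed)
    moreover have "?z + T ?z \<in> perm_alg.span H"
      using that sub by (intro sym closed) blast+
    ultimately have "pa_scale (1 / 2) (?z + ?z) \<in> perm_alg.span H"
      by (simp add: perm_alg.span_scale)
    moreover have "pa_scale (1 / 2) (?z + ?z) = ?z"
      by (rule poly_mapping_eqI) (simp add: lookup_add)
    ultimately show ?thesis
      by simp
  qed
  then show ?thesis
    using sub by (simp add: subalgebra_of_def perm_alg.subspace_span)
qed

lemma W_pm_mult_closed:
  assumes "2 \<le> n" "x \<in> W_pm_space n" "y \<in> W_pm_space n"
  shows "pa_mult x y \<in> W_pm_space n"
  using W_pm_subalgebra[OF assms(1)] assms(2,3) by (simp add: subalgebra_of_def)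

text \<open>Left multiplication by \<open>w0 n\<close> exchanges \<open>W_plus n k\<close> and
  \<open>W_minus n k\<close>. By associativity a product is fixed as soon as its left factor
  is.\<close>

lemma W_subalgebra:
  assumes "2 \<le> n"
  shows "subalgebra_of (W_space n) (W_pm_space n)"
proof -
  let ?I = "{1..n - 1}"
  show ?thesis
    unfolding W_space_def W_pm_space_def
  proof (rule fixed_points_subalgebra[where T = "pa_mult (w0 n)"])
    show "W_both n ` ?I \<subseteq> perm_alg.span (W_plus n ` ?I \<union> W_minus n ` ?I)"
      using W_in_W_pm[OF assms] unfolding W_pm_space_def W_both_def
      by (auto intro: perm_alg.span_add)
    show "pa_mult (w0 n) h = h" if "h \<in> W_both n ` ?I" for h
      using that by (auto simp: W_both_def pa_mult_add_right w0_mult_W[OF assms] add.commute)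
    show "g + pa_mult (w0 n) g \<in> perm_alg.span (W_both n ` ?I)"
      if g: "g \<in> W_plus n ` ?I \<union> W_minus n ` ?I" for g
    proof -
      obtain k where k: "k \<in> ?I" "g = W_plus n k \<or> g = W_minus n k"
        using g by blast
      then have "g + pa_mult (w0 n) g = W_both n k"
        by (auto simp: W_both_def w0_mult_W[OF assms] add.commute)
      with k(1) show ?thesis
        by (auto intro: perm_alg.span_base)
    qed
    show "pa_mult (w0 n) (pa_mult x y) = pa_mult x y" if "pa_mult (w0 n) x = x" for x y
      using that by (simp flip: pa_mult_assoc)
  qed (use W_pm_mult_closed[OF assms] in
      \<open>auto simp: W_pm_space_def pa_mult_add_right pa_mult_scale_right\<close>)
qed

text \<open>Conjugation by \<open>w0 n\<close> is a multiplicative involution that fixes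
  \<open>W_plus n k\<close> and \<open>W_minus n k\<close> for odd \<open>k\<close> and exchanges
  them for even \<open>k\<close>; \<open>H\<close> collects the symmetrized generators up to
  scalars.\<close>

lemma C_subalgebra:
  assumes "2 \<le> n"
  shows "subalgebra_of (C_space n) (W_pm_space n)"
proof -
  let ?G = "W_plus n ` {1..n - 1} \<union> W_minus n ` {1..n - 1}"
  define H where "H = (\<lambda>k. W_both n (2 * k)) ` {1..(n - 1) div 2} \<union>
    ((\<lambda>k. W_plus n (2 * k - 1)) ` {1..n div 2} \<union> (\<lambda>k. W_minus n (2 * k - 1)) ` {1..n div 2})"
  have C: "C_space n = perm_alg.span H"
    by (simp add: H_def C_space_def C_even_space_def C_odd_space_def perm_alg.span_Un)
  have odd_H: "W_plus n k \<in> H" "W_minus n k \<in> H" if "odd k" "k \<in> {1..n - 1}" for k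
  proof -
    obtain j where "k = 2 * j + 1"
      using \<open>odd k\<close> by (elim oddE)
    then have "k = 2 * Suc j - 1" "Suc j \<in> {1..n div 2}"
      using that(2) by auto
    then show "W_plus n k \<in> H" "W_minus n k \<in> H"
      unfolding H_def by blast+
  qed
  have even_H: "W_both n k \<in> H" if "even k" "k \<in> {1..n - 1}" for k
  proof -
    obtain j where "k = 2 * j"
      using \<open>even k\<close> by (elim evenE)
    moreover from this have "j \<in> {1..(n - 1) div 2}"
      using that(2) by auto
    ultimately show ?thesis
      unfolding H_def by blast
  qed
  \<comment> \<open>For odd \<open>k\<close>, \<open>W_minus n k\<close> is \<open>w0 n\<close>
    times \<open>W_plus n k\<close>, and conjugation fixes \<open>w0 n\<close>. For even
    \<open>k\<close> the involution is applied to \<open>conj_w0_W_plus\<close>.\<close>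
  have conj_minus: "conj_w0 n (W_minus n k) = (if odd k then W_minus n k else W_plus n k)" for k
  proof (cases "odd k")
    case True
    have "W_minus n k = pa_mult (w0 n) (W_plus n k)"
      by (simp add: w0_mult_W[OF assms])
    then have "conj_w0 n (W_minus n k) = pa_mult (w0 n) (conj_w0 n (W_plus n k))"
      by (simp add: conj_w0_def pa_mult_assoc)
    with True show ?thesis
      by (simp add: conj_w0_W_plus[OF assms] w0_mult_W[OF assms])
  next
    case False
    then show ?thesis
      using conj_w0_conj_w0[of n "W_plus n k"] by (simp add: conj_w0_W_plus[OF assms])
  qed
  have conj_add: "conj_w0 n (x + y) = conj_w0 n x + conj_w0 n y" for x y
    by (simp add: conj_w0_def pa_mult_add_left pa_mult_add_right)
  show ?thesis
    unfolding C W_pm_space_def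
  proof (rule fixed_points_subalgebra[where T = "conj_w0 n"])
    show "conj_w0 n (x + y) = conj_w0 n x + conj_w0 n y" for x y
      by (rule conj_add)
    show "conj_w0 n (pa_scale c x) = pa_scale c (conj_w0 n x)" for c x
      by (simp add: conj_w0_def pa_mult_scale_left pa_mult_scale_right)
    show "conj_w0 n (pa_mult x y) = pa_mult x y" if "conj_w0 n x = x" "conj_w0 n y = y" for x y
    proof -
      have "pa_mult x y = pa_mult (conj_w0 n x) (conj_w0 n y)"
        by (simp add: that)
      also have "\<dots> = conj_w0 n (pa_mult x y)"
        by (simp add: conj_w0_def pa_mult_assoc w0_mult_w0)
      finally show ?thesis ..
    qed
    show "pa_mult x y \<in> perm_alg.span ?G" if "x \<in> perm_alg.span ?G" "y \<in> perm_alg.span ?G" for x y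
      using W_pm_mult_closed[OF assms] that by (simp add: W_pm_space_def)
    show "H \<subseteq> perm_alg.span ?G"
      using W_in_W_pm[OF assms] unfolding W_pm_space_def W_both_def H_def
      by (auto intro: perm_alg.span_add)
    show "conj_w0 n h = h" if "h \<in> H" for h
      using that unfolding H_def W_both_def
      by (auto simp: conj_add conj_w0_W_plus[OF assms] conj_minus add.commute)
    show "g + conj_w0 n g \<in> perm_alg.span H" if g: "g \<in> ?G" for g
    proof -
      obtain k where k: "k \<in> {1..n - 1}" "g = W_plus n k \<or> g = W_minus n k"
        using g by blast
      show ?thesis
      proof (cases "even k")
        case True
        then have "g + conj_w0 n g = W_both n k"
          using k(2) by (auto simp: W_both_def conj_w0_W_plus[OF assms] conj_minus add.commute)
        then show ?thesis
          using even_H[OF True k(1)] by (simp add: perm_alg.span_base)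
      next
        case False
        \<comment> \<open>For odd index the generator is itself fixed, so symmetrizing doubles an
          element of \<open>H\<close>.\<close>
        then have "conj_w0 n g = g" "g \<in> H"
          using k odd_H[OF False k(1)] by (auto simp: conj_w0_W_plus[OF assms] conj_minus)
        then show ?thesis
          by (simp add: perm_alg.span_add perm_alg.span_base)
      qed
    qed
  qed
qed

section \<open>Directness of the sum\<close>

lemma lookup_span_eq_0:
  assumes "x \<in> perm_alg.span S" "\<And>s. s \<in> S \<Longrightarrow> Poly_Mapping.lookup s \<sigma> = 0"
  shows "Poly_Mapping.lookup x \<sigma> = 0"
  using assms(1) by (induction rule: perm_alg.span_induct_alt) (simp_all add: lookup_add assms(2))

text \<open>The supports of the two spaces are disjoint, separated by the parity of
  \<open>run n \<sigma>\<close>.\<close>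

lemma C_even_Int_C_odd: "C_even_space n \<inter> C_odd_space n = {0}"
proof (intro subset_antisym subsetI)
  fix x assume x: "x \<in> C_even_space n \<inter> C_odd_space n"
  have "Poly_Mapping.lookup x \<sigma> = 0" for \<sigma>
  proof (cases "even (run n \<sigma>)")
    case True
    have "x \<in> C_odd_space n"
      using x by blast
    then show ?thesis
      unfolding C_odd_space_def
    proof (rule lookup_span_eq_0)
      fix s assume "s \<in> (\<lambda>k. W_plus n (2 * k - 1)) ` {1..n div 2} \<union> (\<lambda>k. W_minus n (2 * k - 1)) ` {1..n div 2}"
      then obtain k where "1 \<le> k" "s = W_plus n (2 * k - 1) \<or> s = W_minus n (2 * k - 1)"
        by auto
      \<comment> \<open>Truncated subtraction makes \<open>2 * k - 1\<close> even for
        \<open>k = 0\<close>, hence the bound on \<open>k\<close>.\<close>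
      moreover have "odd (2 * k - 1)" if "1 \<le> k" for k :: nat
        using that by simp
      ultimately show "Poly_Mapping.lookup s \<sigma> = 0"
        using True by (auto simp: W_plus_def W_minus_def lookup_class_sum)
    qed
  next
    case False
    have "x \<in> C_even_space n"
      using x by blast
    then show ?thesis
      unfolding C_even_space_def
    proof (rule lookup_span_eq_0)
      fix s assume "s \<in> (\<lambda>k. W_both n (2 * k)) ` {1..(n - 1) div 2}"
      then show "Poly_Mapping.lookup s \<sigma> = 0"
        using False by (auto simp: W_both_def W_plus_def W_minus_def lookup_class_sum lookup_add)
    qed
  qed
  then show "x \<in> {0}"
    by (auto intro: poly_mapping_eqI)
qed (simp add: C_even_space_def C_odd_space_def perm_alg.span_zero)

theorem theorem3p2:
  fixes n :: nat
  assumes "n \<ge> 2"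
  shows "subalgebra_of (W_pm_space n) (descent_algebra n)
    \<and> subalgebra_of (W_space n) (W_pm_space n)
    \<and> subalgebra_of (W_left_space n) (W_pm_space n)
    \<and> C_even_space n \<inter> C_odd_space n = {0}
    \<and> subalgebra_of (C_space n) (W_pm_space n)
    \<and> subalgebra_of (P_space n) (W_pm_space n)
    \<and> subalgebra_of (P_left_space n) (W_pm_space n)"
  using W_pm_subalgebra[OF assms] W_subalgebra[OF assms] W_left_subalgebra[OF assms]
    C_even_Int_C_odd C_subalgebra[OF assms] P_subalgebra[OF assms] P_left_subalgebra[OF assms]
  by blast

end
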